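(* Let $\kappa<\mathfrak c$ be a cardinal number such that Martin's axiom for $\kappa$, $\mathrm{MA}(\kappa)$, holds. Then the compact space $2^{\kappa}$ has the $^*$extension property, and hence every twisted sum of $c_0$ and $C(2^{\kappa})$ is trivial.
   Context: Compact spaces are Hausdorff; $\mathfrak c=2^{\aleph_0}$; $2^\kappa=\{0,1\}^\kappa$ carries the product topology. For compact $K$, $C(K)$ is the Banach space of continuous real-valued functions on $K$, and $C(K)^*$ is identified with the space $M(K)$ of signed Radon measures on $K$ of finite variation. $M_1(K)$ is the closed unit ball of $M(K)$ with the weak$^*$ topology; write $\nu(g)=\int g\,d\nu$. A compact space $L'\supseteq L$ is a countable discrete extension of a compact space $L$ if $L'\setminus L$ is countable and discrete. A compact space $K$ has the $^*$extension property if for every countable discrete extension $L'$ of $M_1(K)$ there is a bounded linear operator $E:C(K)\to C(L')$ such that $Eg(\nu)=\nu(g)$ for all $g\in C(K)$ and $\nu\in M_1(K)$. A twisted sum of Banach spaces $Z$ and $Y$ is a short exact sequence $0\to Z\to X\to Y\to 0$ with $X$ a Banach space and the maps bounded linear operators; it is trivial if it splits, i.e. the map $Z\to X$ has a bounded linear left inverse (equivalently, the range of $Z\to X$ is complemented in $X$). $\mathrm{MA}(\kappa)$: for every nonempty partially ordered set $(\mathbb P,\le)$ satisfying ccc (every uncountable subset of $\mathbb P$ contains two distinct elements $p_1,p_2$ having a common upper bound $q\in\mathbb P$, $p_1,p_2\le q$) and every family $\{\mathbb D_\xi:\xi<\kappa\}$ of dense subsets of $\mathbb P$ (for every $p\in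 \mathbb P$ there is $d\in \mathbb D_\xi$ with $p\le d$), there is a directed set $\mathbb G\subseteq\mathbb P$ (any $p_1,p_2\in\mathbb G$ have an upper bound in $\mathbb G$) with $\mathbb G\cap\mathbb D_\xi\neq\emptyset$ for every $\xi<\kappa$. *)

theory Defs
  imports "HOL-Analysis.Analysis"
begin

section \<open>Martin's axiom\<close>

definition ccc :: "'p set \<Rightarrow> 'p rel \<Rightarrow> bool" where
  "ccc P le \<longleftrightarrow> (\<forall>A\<subseteq>P. uncountable A \<longrightarrow>
     (\<exists>p\<^sub>1\<in>A. \<exists>p\<^sub>2\<in>A. p\<^sub>1 \<noteq> p\<^sub>2 \<and> (\<exists>q\<in>P. (p\<^sub>1, q) \<in> le \<and> (p\<^sub>2, q) \<in> le)))"

definition dense_in_poset :: "'p set \<Rightarrow> 'p rel \<Rightarrow> 'p set \<Rightarrow> bool" where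
  "dense_in_poset P le D \<longleftrightarrow> D \<subseteq> P \<and> (\<forall>p\<in>P. \<exists>d\<in>D. (p, d) \<in> le)"

definition directed_in_poset :: "'p set \<Rightarrow> 'p rel \<Rightarrow> 'p set \<Rightarrow> bool" where
  "directed_in_poset P le G \<longleftrightarrow> G \<subseteq> P \<and>
     (\<forall>p\<^sub>1\<in>G. \<forall>p\<^sub>2\<in>G. \<exists>q\<in>G. (p\<^sub>1, q) \<in> le \<and> (p\<^sub>2, q) \<in> le)"

text \<open>
  The cardinal \<open>\<kappa>\<close> is the cardinality of the index set \<open>I\<close>. A formula of HOL cannot
  quantify over types, so the posets considered are those whose carrier is a subset of a
  type \<open>'p\<close>. The theorem \<open>martin_axiom_universe\<close> below shows that the type
  \<open>nat set\<close> (of cardinality \<open>2\<^sup>\<aleph>\<^sup>0\<close>) already yields the axiom for posets on every type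
  whenever \<open>\<kappa> \<le> 2\<^sup>\<aleph>\<^sup>0\<close>.
\<close>

definition martin_axiom :: "'p itself \<Rightarrow> 'i set \<Rightarrow> bool" where
  "martin_axiom (_ :: 'p itself) I \<longleftrightarrow>
     (\<forall>(P :: 'p set) le (D :: 'i \<Rightarrow> 'p set).
        P \<noteq> {} \<and> partial_order_on P le \<and> ccc P le \<and> (\<forall>\<xi>\<in>I. dense_in_poset P le (D \<xi>)) \<longrightarrow>
        (\<exists>G. directed_in_poset P le G \<and> (\<forall>\<xi>\<in>I. G \<inter> D \<xi> \<noteq> {})))"

datatype 'i ma_term = Base | Upper "'i ma_term" "'i ma_term" | Dense 'i "'i ma_term"

definition pair_code :: "nat set \<Rightarrow> nat set \<Rightarrow> nat set" where
  "pair_code A B = (\<lambda>n. 2 * n) ` A \<union> (\<lambda>n. 2 * n + 1) ` B"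

lemma pair_code_inject [simp]: "pair_code A B = pair_code A' B' \<longleftrightarrow> A = A' \<and> B = B'"
proof
  have ev: "{n. 2 * n \<in> pair_code X Y} = X" for X Y
    unfolding pair_code_def by auto presburger
  have od: "{n. 2 * n + 1 \<in> pair_code X Y} = Y" for X Y
    unfolding pair_code_def by auto presburger
  assume "pair_code A B = pair_code A' B'"
  then show "A = A' \<and> B = B'" using ev od by metis
qed simp

primrec term_code :: "('i \<Rightarrow> nat set) \<Rightarrow> 'i ma_term \<Rightarrow> nat set" where
  "term_code f Base = pair_code {} {}"
| "term_code f (Upper s t) = pair_code {0} (pair_code (term_code f s) (term_code f t))"
| "term_code f (Dense i t) = pair_code {1} (pair_code (f i) (term_code f t))"

lemma term_code_inject:
  assumes "inj_on f I" "set_ma_term s \<subseteq> I" "set_ma_term t \<subseteq> I" "term_code f s = term_code f t"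
  shows "s = t"
  using assms(2-4)
proof (induction s arbitrary: t)
  case Base
  then show ?case by (cases t) auto
next
  case (Upper s1 s2)
  then show ?case by (cases t) auto
next
  case (Dense i s)
  then show ?case using assms(1) by (cases t) (auto dest: inj_onD)
qed

primrec term_val :: "'p set \<Rightarrow> 'p rel \<Rightarrow> ('i \<Rightarrow> 'p set) \<Rightarrow> 'p \<Rightarrow> 'i ma_term \<Rightarrow> 'p" where
  "term_val P le D p Base = p"
| "term_val P le D p (Upper s t) =
     (if \<exists>q\<in>P. (term_val P le D p s, q) \<in> le \<and> (term_val P le D p t, q) \<in> le
      then SOME q. q \<in> P \<and> (term_val P le D p s, q) \<in> le \<and> (term_val P le D p t, q) \<in> le
      else p)"
| "term_val P le D p (Dense i t) = (SOME d. d \<in> D i \<and> (term_val P le D p t, d) \<in> le)"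

theorem martin_axiom_universe:
  fixes I :: "'i set"
  assumes I: "I \<lesssim> (UNIV :: nat set set)" and MA: "martin_axiom TYPE(nat set) I"
  shows "martin_axiom TYPE('q) I"
  unfolding martin_axiom_def
proof (intro allI impI)
  fix P :: "'q set" and le :: "'q rel" and D :: "'i \<Rightarrow> 'q set"
  assume "P \<noteq> {} \<and> partial_order_on P le \<and> ccc P le \<and> (\<forall>\<xi>\<in>I. dense_in_poset P le (D \<xi>))"
  then obtain p where p: "p \<in> P" and po: "partial_order_on P le" and c: "ccc P le"
    and D: "\<And>\<xi>. \<xi> \<in> I \<Longrightarrow> dense_in_poset P le (D \<xi>)" by blast
  obtain f :: "'i \<Rightarrow> nat set" where f: "inj_on f I"
    using I unfolding lepoll_def by blast
  define T where "T = {t :: 'i ma_term. set_ma_term t \<subseteq> I}"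
  define v where "v = term_val P le D p"
  define Q where "Q = v ` T"
  have vD: "v (Dense i t) \<in> D i \<and> (v t, v (Dense i t)) \<in> le" if "i \<in> I" "v t \<in> P" for i t
  proof -
    have "\<exists>d. d \<in> D i \<and> (v t, d) \<in> le"
      using D[OF that(1)] that(2) unfolding dense_in_poset_def by blast
    from someI_ex[OF this] show ?thesis by (simp add: v_def)
  qed
  have vU: "v (Upper s t) \<in> P \<and> (v s, v (Upper s t)) \<in> le \<and> (v t, v (Upper s t)) \<in> le"
    if "\<exists>q\<in>P. (v s, q) \<in> le \<and> (v t, q) \<in> le" for s t
  proof -
    have "\<exists>q. q \<in> P \<and> (v s, q) \<in> le \<and> (v t, q) \<in> le" using that by blast
    from someI_ex[OF this] that show ?thesis by (simp add: v_def)
  qed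
  have vP: "v t \<in> P" if "t \<in> T" for t
    using that
  proof (induction t)
    case Base
    then show ?case using p by (simp add: v_def)
  next
    case (Upper s t)
    show ?case
    proof (cases "\<exists>q\<in>P. (v s, q) \<in> le \<and> (v t, q) \<in> le")
      case True
      then show ?thesis using vU by blast
    next
      case False
      then have "v (Upper s t) = p" unfolding v_def term_val.simps by (rule if_not_P)
      then show ?thesis using p by simp
    qed
  next
    case (Dense i t)
    then have "i \<in> I" "v t \<in> P" by (auto simp: T_def)
    then show ?case using vD D unfolding dense_in_poset_def by blast
  qed
  have QP: "Q \<subseteq> P" using vP unfolding Q_def by blast
  have Qub: "\<exists>q\<in>Q. (a, q) \<in> le \<and> (b, q) \<in> le"
    if ab: "a \<in> Q" "b \<in> Q" and q: "\<exists>q\<in>P. (a, q) \<in> le \<and> (b, q) \<in> le" for a b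
  proof -
    obtain s t where st: "s \<in> T" "t \<in> T" "a = v s" "b = v t" using ab unfolding Q_def by blast
    then have "Upper s t \<in> T" unfolding T_def by auto
    then show ?thesis using vU[of s t] q st unfolding Q_def by blast
  qed
  have QD: "\<exists>d\<in>D \<xi> \<inter> Q. (a, d) \<in> le" if "a \<in> Q" "\<xi> \<in> I" for a \<xi>
  proof -
    obtain t where t: "t \<in> T" "a = v t" using \<open>a \<in> Q\<close> unfolding Q_def by blast
    then have "Dense \<xi> t \<in> T" using \<open>\<xi> \<in> I\<close> unfolding T_def by auto
    then show ?thesis using vD[OF \<open>\<xi> \<in> I\<close> vP[OF t(1)]] t(2) unfolding Q_def by blast
  qed
  define h where "h a = term_code f (SOME t. t \<in> T \<and> v t = a)" for a
  have h: "inj_on h Q"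
  proof (rule inj_onI)
    fix a b assume ab: "a \<in> Q" "b \<in> Q" "h a = h b"
    have *: "(SOME t. t \<in> T \<and> v t = x) \<in> T \<and> v (SOME t. t \<in> T \<and> v t = x) = x" if "x \<in> Q" for x
      by (rule someI_ex) (use that in \<open>auto simp: Q_def\<close>)
    show "a = b"
      using term_code_inject[OF f] ab *[OF ab(1)] *[OF ab(2)] unfolding h_def T_def
      by (metis (no_types, lifting) mem_Collect_eq)
  qed
  have hD: "a = b" if "h a = h b" "a \<in> Q" "b \<in> Q" for a b
    using inj_onD[OF h that] .
  define P' where "P' = h ` Q"
  define le' where "le' = {(h a, h b) | a b. a \<in> Q \<and> b \<in> Q \<and> (a, b) \<in> le}"
  define D' where "D' \<xi> = h ` (D \<xi> \<inter> Q)" for \<xi>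
  have le': "(h a, h b) \<in> le' \<longleftrightarrow> (a, b) \<in> le" if "a \<in> Q" "b \<in> Q" for a b
  proof
    assume "(h a, h b) \<in> le'"
    then obtain a' b' where *: "h a = h a'" "h b = h b'" "a' \<in> Q" "b' \<in> Q" "(a', b') \<in> le"
      unfolding le'_def by blast
    then show "(a, b) \<in> le" using hD[OF *(1) that(1) *(3)] hD[OF *(2) that(2) *(4)] by simp
  qed (use that in \<open>auto simp: le'_def\<close>)
  have refl: "(a, a) \<in> le" if "a \<in> P" for a
    using po that unfolding partial_order_on_def preorder_on_def refl_on_def by blast
  have trans: "trans le" and anti: "antisym le"
    using po unfolding partial_order_on_def preorder_on_def by auto
  have "P' \<noteq> {}"
  proof -
    have "Base \<in> T" by (simp add: T_def)
    then show ?thesis unfolding P'_def Q_def by blast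
  qed
  moreover have "partial_order_on P' le'"
    unfolding partial_order_on_def preorder_on_def
  proof (intro conjI)
    show "le' \<subseteq> P' \<times> P'" unfolding le'_def P'_def by blast
    show "refl_on P' le'"
      unfolding refl_on_def P'_def using le' refl QP by blast
    show "trans le'"
    proof (rule transI)
      fix x y z assume "(x, y) \<in> le'" "(y, z) \<in> le'"
      then obtain a b b' c where *: "x = h a" "y = h b" "y = h b'" "z = h c" "a \<in> Q" "b \<in> Q"
        "b' \<in> Q" "c \<in> Q" "(a, b) \<in> le" "(b', c) \<in> le" unfolding le'_def by blast
      then have "b = b'" using hD[of b b'] by simp
      then have "(a, c) \<in> le" using * transD[OF trans] by blast
      then show "(x, z) \<in> le'" using * le' by blast
    qed
    show "antisym le'"
    proof (rule antisymI)
      fix x y assume "(x, y) \<in> le'" "(y, x) \<in> le'"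
      then obtain a b where *: "x = h a" "y = h b" "a \<in> Q" "b \<in> Q" "(a, b) \<in> le"
        unfolding le'_def by blast
      then have "(b, a) \<in> le" using \<open>(y, x) \<in> le'\<close> le' by blast
      then have "a = b" using *(5) antisymD[OF anti] by blast
      then show "x = y" using * by simp
    qed
  qed
  moreover have "ccc P' le'"
    unfolding ccc_def
  proof (intro allI impI)
    fix A' assume A': "A' \<subseteq> P'" "uncountable A'"
    define A where "A = {a\<in>Q. h a \<in> A'}"
    have "A' = h ` A" using A'(1) unfolding A_def P'_def by blast
    then have "uncountable A" using A'(2) by auto
    moreover have "A \<subseteq> P" using QP unfolding A_def by blast
    ultimately obtain a b where ab: "a \<in> A" "b \<in> A" "a \<noteq> b" "\<exists>q\<in>P. (a, q) \<in> le \<and> (b, q) \<in> le"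
      using c unfolding ccc_def by meson
    then have Q: "a \<in> Q" "b \<in> Q" unfolding A_def by auto
    obtain q where q: "q \<in> Q" "(a, q) \<in> le" "(b, q) \<in> le" using Qub[OF Q ab(4)] by blast
    have "h a \<noteq> h b" using ab(3) Q hD by blast
    moreover have "(h a, h q) \<in> le'" "(h b, h q) \<in> le'" using le' Q q by blast+
    moreover have "h a \<in> A'" "h b \<in> A'" "h q \<in> P'" using ab q unfolding A_def P'_def by auto
    ultimately show "\<exists>p\<^sub>1\<in>A'. \<exists>p\<^sub>2\<in>A'. p\<^sub>1 \<noteq> p\<^sub>2 \<and> (\<exists>q\<in>P'. (p\<^sub>1, q) \<in> le' \<and> (p\<^sub>2, q) \<in> le')"
      by blast
  qed
  moreover have "\<forall>\<xi>\<in>I. dense_in_poset P' le' (D' \<xi>)"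
    unfolding dense_in_poset_def
  proof (intro ballI conjI)
    fix \<xi> assume \<xi>: "\<xi> \<in> I"
    show "D' \<xi> \<subseteq> P'" unfolding D'_def P'_def by blast
    fix x assume "x \<in> P'"
    then obtain a where a: "a \<in> Q" "x = h a" unfolding P'_def by blast
    obtain d where "d \<in> D \<xi> \<inter> Q" "(a, d) \<in> le" using QD[OF a(1) \<xi>] by blast
    then show "\<exists>d\<in>D' \<xi>. (x, d) \<in> le'" using a le' unfolding D'_def by blast
  qed
  ultimately obtain G' where G': "directed_in_poset P' le' G'" "\<forall>\<xi>\<in>I. G' \<inter> D' \<xi> \<noteq> {}"
    using MA[unfolded martin_axiom_def, rule_format, of P' le' D'] by meson
  define G where "G = {a\<in>Q. h a \<in> G'}"
  have "directed_in_poset P le G"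
    unfolding directed_in_poset_def
  proof (intro conjI ballI)
    show "G \<subseteq> P" using QP unfolding G_def by blast
    fix a b assume ab: "a \<in> G" "b \<in> G"
    then have Q: "a \<in> Q" "b \<in> Q" "h a \<in> G'" "h b \<in> G'" unfolding G_def by auto
    then obtain x where x: "x \<in> G'" "(h a, x) \<in> le'" "(h b, x) \<in> le'"
      using G'(1) unfolding directed_in_poset_def by blast
    then obtain q where q: "x = h q" "q \<in> Q" unfolding le'_def by blast
    then have "q \<in> G" "(a, q) \<in> le" "(b, q) \<in> le"
      using x le' Q unfolding G_def by blast+
    then show "\<exists>q\<in>G. (a, q) \<in> le \<and> (b, q) \<in> le" by blast
  qed
  moreover have "\<forall>\<xi>\<in>I. G \<inter> D \<xi> \<noteq> {}"
    using G'(2) unfolding G_def D'_def by blast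
  ultimately show "\<exists>G. directed_in_poset P le G \<and> (\<forall>\<xi>\<in>I. G \<inter> D \<xi> \<noteq> {})" by blast
qed


section \<open>The Banach spaces \<open>C(K)\<close> and \<open>c\<^sub>0\<close>\<close>

text \<open>
  For a compact space \<open>K\<close> carried by the type \<open>'a\<close>, \<open>C(K)\<close> is \<open>'a \<Rightarrow>\<^sub>C real\<close>. The library
  proves its completeness only for metric domains.
\<close>

instance bcontfun :: (topological_space, complete_space) complete_space
proof
  fix f :: "nat \<Rightarrow> 'a \<Rightarrow>\<^sub>C 'b"
  assume "Cauchy f"
  then obtain g where "uniform_limit UNIV f g sequentially"
    using uniformly_convergent_eq_cauchy[of "\<lambda>_. True" f]
    unfolding Cauchy_def uniform_limit_sequentially_iff
    by (metis dist_fun_lt_imp_dist_val_lt)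
  from uniform_limit_bcontfunE[OF this sequentially_bot]
  obtain l where "g = apply_bcontfun l" "f \<longlonglongrightarrow> l" by metis
  then show "convergent f" by (intro convergentI)
qed

instance bcontfun :: (topological_space, banach) banach ..

text \<open>Every real sequence is continuous on the discrete space \<open>nat\<close>, so \<open>nat \<Rightarrow>\<^sub>C real\<close> is
  the space of bounded sequences.\<close>

typedef c0 = "{x :: nat \<Rightarrow>\<^sub>C real. apply_bcontfun x \<longlonglongrightarrow> 0}"
  morphisms seq_of_c0 Abs_c0
  by (rule exI[of _ 0]) auto

setup_lifting type_definition_c0

instantiation c0 :: real_normed_vector
begin

lift_definition zero_c0 :: c0 is 0 by auto
lift_definition plus_c0 :: "c0 \<Rightarrow> c0 \<Rightarrow> c0" is "(+)"
  using tendsto_add[of _ 0 _ _ 0] by auto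
lift_definition minus_c0 :: "c0 \<Rightarrow> c0 \<Rightarrow> c0" is "(-)"
  using tendsto_diff[of _ 0 _ _ 0] by auto
lift_definition uminus_c0 :: "c0 \<Rightarrow> c0" is "uminus"
  using tendsto_minus[of _ 0] by auto
lift_definition scaleR_c0 :: "real \<Rightarrow> c0 \<Rightarrow> c0" is "(*\<^sub>R)"
  by (auto intro: tendsto_mult_right_zero)
lift_definition norm_c0 :: "c0 \<Rightarrow> real" is norm .
lift_definition dist_c0 :: "c0 \<Rightarrow> c0 \<Rightarrow> real" is dist .

definition sgn_c0 :: "c0 \<Rightarrow> c0" where "sgn_c0 x = inverse (norm x) *\<^sub>R x"
definition uniformity_c0 :: "(c0 \<times> c0) filter"
  where "uniformity_c0 = (INF e\<in>{0 <..}. principal {(x, y). dist x y < e})"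
definition open_c0 :: "c0 set \<Rightarrow> bool"
  where "open_c0 S = (\<forall>x\<in>S. \<forall>\<^sub>F (x', y) in uniformity. x' = x \<longrightarrow> y \<in> S)"

instance
proof
  fix x y z :: c0 and a b :: real
  show "x + y + z = x + (y + z)" "x + y = y + x" "0 + x = x" "- x + x = 0" "x - y = x + - y"
    by (transfer; simp)+
  show "a *\<^sub>R (x + y) = a *\<^sub>R x + a *\<^sub>R y" "(a + b) *\<^sub>R x = a *\<^sub>R x + b *\<^sub>R x"
    "a *\<^sub>R b *\<^sub>R x = (a * b) *\<^sub>R x" "1 *\<^sub>R x = x"
    by (transfer; simp add: scaleR_add_left scaleR_add_right)+
  show "dist x y = norm (x - y)" by (transfer; simp add: dist_norm)
  show "norm x = 0 \<longleftrightarrow> x = 0" by (transfer; simp)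
  show "norm (x + y) \<le> norm x + norm y" by (transfer; rule norm_triangle_ineq)
  show "norm (a *\<^sub>R x) = \<bar>a\<bar> * norm x" by (transfer; simp)
qed (rule sgn_c0_def uniformity_c0_def open_c0_def)+

end

instance c0 :: banach
proof
  fix X :: "nat \<Rightarrow> c0"
  assume X: "Cauchy X"
  have "Cauchy (\<lambda>n. seq_of_c0 (X n))"
    using X unfolding Cauchy_def dist_c0.rep_eq .
  then obtain l where l: "(\<lambda>n. seq_of_c0 (X n)) \<longlonglongrightarrow> l"
    using Cauchy_convergent convergent_def by blast
  have "apply_bcontfun l \<longlonglongrightarrow> 0"
  proof (rule swap_uniform_limit')
    show "\<forall>\<^sub>F n in sequentially. apply_bcontfun (seq_of_c0 (X n)) \<longlonglongrightarrow> 0"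
      using seq_of_c0 by simp
    show "uniform_limit UNIV (\<lambda>n. apply_bcontfun (seq_of_c0 (X n))) (apply_bcontfun l) sequentially"
      by (rule tendsto_bcontfun_uniform_limit[OF l])
  qed auto
  then obtain y where y: "l = seq_of_c0 y"
    using seq_of_c0_cases by blast
  have "X \<longlonglongrightarrow> y"
    using l unfolding y tendsto_dist_iff[of "\<lambda>n. seq_of_c0 (X n)"] tendsto_dist_iff[of X]
    by (simp add: dist_c0.rep_eq)
  then show "convergent X" by (rule convergentI)
qed


section \<open>Countable discrete extensions and the \<open>\<^sup>*\<close>extension property\<close>

text \<open>The inclusion of \<open>L\<close> in \<open>L'\<close> is given as a topological embedding \<open>e\<close>.\<close>

definition countable_discrete_extension :: "'b topology \<Rightarrow> 'l topology \<Rightarrow> ('b \<Rightarrow> 'l) \<Rightarrow> bool" where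
  "countable_discrete_extension L L' e \<longleftrightarrow>
     compact_space L' \<and> Hausdorff_space L' \<and> embedding_map L L' e \<and>
     countable (topspace L' - e ` topspace L) \<and>
     subtopology L' (topspace L' - e ` topspace L) =
       discrete_topology (topspace L' - e ` topspace L)"

text \<open>
  \<open>M(K)\<close> is the dual space \<open>C(K)\<^sup>*\<close>, \<open>\<nu>(g)\<close> being the value of the functional \<open>\<nu>\<close> at \<open>g\<close>;
  the operator norm is the variation norm. On functionals the strong operator topology, i.e.
  that of pointwise convergence, is the weak\<open>\<^sup>*\<close> topology.
\<close>

definition M1 :: "(('a::t2_space \<Rightarrow>\<^sub>C real) \<Rightarrow>\<^sub>L real) topology" where
  "M1 = subtopology strong_operator_topology (cball 0 1)"

text \<open>Bounded linear operators from a normed space into the space of continuous functions on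
  the compact space \<open>L'\<close> with the supremum norm; only the values on \<open>topspace L'\<close> matter.\<close>

definition bounded_operator_into_C ::
  "'l topology \<Rightarrow> ('v::real_normed_vector \<Rightarrow> 'l \<Rightarrow> real) \<Rightarrow> bool" where
  "bounded_operator_into_C L' E \<longleftrightarrow>
     (\<forall>g. continuous_map L' euclideanreal (E g)) \<and>
     (\<forall>x\<in>topspace L'. linear (\<lambda>g. E g x)) \<and>
     (\<exists>B. \<forall>g. \<forall>x\<in>topspace L'. \<bar>E g x\<bar> \<le> B * norm g)"

text \<open>The extensions \<open>L'\<close> range over all topologies on the type \<open>'l\<close>. With \<open>'l\<close> a free type
  variable in the conclusion of a theorem, they are arbitrary.\<close>

definition star_extension_property :: "'a::t2_space itself \<Rightarrow> 'l itself \<Rightarrow> bool" where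
  "star_extension_property (_ :: 'a itself) (_ :: 'l itself) \<longleftrightarrow>
     (\<forall>(L' :: 'l topology) (e :: (('a \<Rightarrow>\<^sub>C real) \<Rightarrow>\<^sub>L real) \<Rightarrow> 'l).
        countable_discrete_extension M1 L' e \<longrightarrow>
        (\<exists>E :: ('a \<Rightarrow>\<^sub>C real) \<Rightarrow> 'l \<Rightarrow> real.
           bounded_operator_into_C L' E \<and>
           (\<forall>g. \<forall>\<nu>\<in>topspace M1. E g (e \<nu>) = blinfun_apply \<nu> g)))"


section \<open>Twisted sums\<close>

definition twisted_sum ::
  "('z::banach \<Rightarrow> 'x::banach) \<Rightarrow> ('x \<Rightarrow> 'y::banach) \<Rightarrow> bool" where
  "twisted_sum i q \<longleftrightarrow> bounded_linear i \<and> bounded_linear q \<and>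
     inj i \<and> range i = {x. q x = 0} \<and> surj q"

definition trivial_twisted_sum ::
  "('z::banach \<Rightarrow> 'x::banach) \<Rightarrow> ('x \<Rightarrow> 'y::banach) \<Rightarrow> bool" where
  "trivial_twisted_sum i q \<longleftrightarrow> twisted_sum i q \<and> (\<exists>r. bounded_linear r \<and> (\<forall>z. r (i z) = z))"


section \<open>Cantor cubes\<close>

definition cantor_cube :: "'i set \<Rightarrow> ('i \<Rightarrow> bool) topology" where
  "cantor_cube I = product_topology (\<lambda>_. discrete_topology UNIV) I"

lemma euclidean_eq_cantor_cube: "(euclidean :: ('i \<Rightarrow> bool) topology) = cantor_cube UNIV"
proof -
  have "discrete_topology (UNIV :: bool set) = euclidean"
    by (simp add: topology_eq open_discrete)
  then show ?thesis
    by (simp add: cantor_cube_def euclidean_product_topology)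
qed

end

theory Submission
  imports Defs
begin

text \<open>
  Let \<open>chi T\<close> be the indicator function of the points of the cube that have the value 1 at every
  coordinate in the finite set \<open>T\<close>. The linear span of these functions is dense in \<open>C(2\<^sup>\<kappa>)\<close>
  (\<open>chi_total\<close>), so a bounded sequence of functionals is controlled by its values at them.

  Both parts of the theorem ask for such a sequence. Numbers \<open>a n T\<close> are given, for \<open>n\<close> in a countable
  set, and a bounded sequence of functionals \<open>\<mu> n\<close> is wanted with \<open>\<mu> n (chi T) - a n T\<close> tending to 0
  for each \<open>T\<close>. In a countable discrete extension of \<open>M\<^sub>1\<close>, the number \<open>a n T\<close> is the value at the
  isolated point \<open>n\<close> of a continuous extension of the evaluation at \<open>chi T\<close>; in a twisted sum of
  \<open>c\<^sub>0\<close> and \<open>C(2\<^sup>\<kappa>)\<close>, it is the value of an extended coordinate functional at a preimage of \<open>chi T\<close>. In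
  both cases a soft argument shows that finitely many sets \<open>T\<close> can be handled: given a finite \<open>S\<close> and a
  precision, for all but finitely many \<open>n\<close> some functional of norm at most \<open>B\<close> has nearly the right
  values at all \<open>chi T\<close> with \<open>T\<close> within \<open>S\<close>. The lemma \<open>martin_functionals\<close> passes from this to all \<open>T\<close>
  at once.

  The forcing conditions are finite parts of the sequence, taken from a countable set of functionals,
  with finitely many requirements on its later members (\<open>martin_selection\<close>). A countable set suffices
  because the balls of \<open>M(2\<^sup>\<kappa>)\<close> are weak\<open>\<^sup>*\<close> separable for \<open>\<kappa> \<le> 2\<^sup>\<aleph>\<^sup>0\<close>
  (\<open>countable_dense_functionals\<close>). The countable chain condition is the crucial point, since in
  general two such conditions with the same finite part may well be incompatible. It holds here
  because the functionals can be amalgamated (\<open>amalgamate_functionals\<close>): if \<open>\<nu>\<close> is right for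
  the finite set \<open>S\<close> and \<open>\<nu>'\<close> for \<open>S'\<close>, let \<open>restriction S \<nu>\<close> be the image of \<open>\<nu>\<close> under the map that
  sets all coordinates outside \<open>S\<close> to 0; then
  \<open>restriction S' \<nu>' + restriction S \<nu> - restriction (S \<inter> S') \<nu>\<close> is right for both sets, and its norm
  is at most three times the given bound. So all conditions with the same finite part are compatible.
\<close>

section \<open>Open mapping, Hahn-Banach and Banach-Alaoglu theorems\<close>

text \<open>
  The closed range is complete, so Baire's theorem gives a ball of it in which every point is a
  limit of images of one fixed ball of the domain. By scaling, every point of the range has an
  approximate preimage of comparable norm, with error at most half the norm of the point.
  Correcting the error again and again gives a geometric series that sums to an exact preimage.
\<close>

lemma open_mapping_closed_range:
  fixes f :: "'a::banach \<Rightarrow> 'b::banach"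
  assumes f: "bounded_linear f" and cl: "closed (range f)"
  obtains C where "C > 0" "\<And>y. y \<in> range f \<Longrightarrow> \<exists>x. f x = y \<and> norm x \<le> C * norm y"
proof -
  interpret f: bounded_linear f by (rule f)
  define Y where "Y = range f"
  define F where "F n = closure (f ` cball 0 (real n))" for n
  have Y: "subspace Y"
    unfolding Y_def using linear_subspace_image[OF f.linear subspace_UNIV] .
  have FY: "F n \<subseteq> Y" for n
    unfolding F_def Y_def using cl by (intro closure_minimal) auto
  have UF: "(\<Union>n. F n) = Y"
  proof
    show "Y \<subseteq> (\<Union>n. F n)"
    proof
      fix y assume "y \<in> Y"
      then obtain x where x: "y = f x" unfolding Y_def by blast
      obtain n where "norm x \<le> real n" using real_arch_simple by blast
      then have "y \<in> f ` cball 0 (real n)" using x by simp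
      then show "y \<in> (\<Union>n. F n)" unfolding F_def using closure_subset by fast
    qed
  qed (use FY in blast)
  have "\<exists>n. top_of_set Y interior_of F n \<noteq> {}"
  proof (rule ccontr)
    assume "\<not> (\<exists>n. top_of_set Y interior_of F n \<noteq> {})"
    then have "top_of_set Y interior_of \<Union>(range F) = {}"
    proof (intro Baire_category_alt disjI1 conjI)
      show "completely_metrizable_space (top_of_set Y)"
        using cl closed_closedin completely_metrizable_space_closedin
          completely_metrizable_space_euclidean unfolding Y_def by blast
    next
      fix T assume "T \<in> range F"
      then show "closedin (top_of_set Y) T"
        using FY by (auto simp: F_def closedin_closed_eq closedin_subset_trans
            intro!: closed_subset)
    qed auto
    moreover have "top_of_set Y interior_of \<Union>(range F) = Y"
      using UF interior_of_topspace[of "top_of_set Y"] by simp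
    ultimately show False unfolding Y_def by blast
  qed
  then obtain n y0 where "y0 \<in> top_of_set Y interior_of F n" by blast
  then obtain U where U: "openin (top_of_set Y) U" "y0 \<in> U" "U \<subseteq> F n"
    unfolding interior_of_def by blast
  then obtain r where r: "r > 0" "ball y0 r \<inter> Y \<subseteq> F n"
    unfolding openin_contains_ball by blast
  have y0: "y0 \<in> F n" "y0 \<in> Y" using U FY by auto
  \<comment> \<open>The ball around \<open>y0\<close> is moved to the origin by subtracting preimages, hence the factor 2.\<close>
  have near: "\<exists>x. norm x \<le> 2 * n \<and> norm (y - f x) < e" if y: "y \<in> Y" "norm y < r" and e: "e > 0" for y e
  proof -
    have "y0 + y \<in> Y" using y(1) y0(2) subspace_add[OF Y] by blast
    then have "y0 + y \<in> F n" using r y by (auto simp: dist_norm)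
    then obtain u where u: "norm u \<le> n" "dist (f u) (y0 + y) < e/2"
      unfolding F_def closure_approachable using half_gt_zero[OF e] by (metis imageE mem_cball_0)
    obtain v where v: "norm v \<le> n" "dist (f v) y0 < e/2"
      using y0(1) half_gt_zero[OF e] unfolding F_def closure_approachable by (metis imageE mem_cball_0)
    have "y - f (u - v) = - ((f u - (y0 + y)) - (f v - y0))" by (simp add: f.diff)
    then have "norm (y - f (u - v)) \<le> norm (f u - (y0 + y)) + norm (f v - y0)"
      by (metis norm_minus_cancel norm_triangle_ineq4)
    then have "norm (y - f (u - v)) < e" using u v by (simp add: dist_norm)
    moreover have "norm (u - v) \<le> 2 * n" using u v norm_triangle_ineq4[of u v] by linarith
    ultimately show ?thesis by blast
  qed
  define K where "K = 4 * real n / r"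
  have K: "K \<ge> 0" using r by (simp add: K_def)
  have step: "\<exists>x. norm x \<le> K * norm y \<and> norm (y - f x) \<le> norm y / 2" if y: "y \<in> Y" for y
  proof (cases "y = 0")
    case True
    then show ?thesis by (intro exI[of _ 0]) (simp add: f.zero)
  next
    case False
    define t where "t = 2 * norm y / r"
    have t: "t > 0" using False r by (simp add: t_def)
    have "(1/t) *\<^sub>R y \<in> Y" by (rule subspace_scale[OF Y y])
    moreover have "norm ((1/t) *\<^sub>R y) < r" using False r by (simp add: t_def field_simps)
    ultimately obtain x where x: "norm x \<le> 2 * n" "norm ((1/t) *\<^sub>R y - f x) < r/4"
      using near[of _ "r/4"] r by force
    have "y - f (t *\<^sub>R x) = t *\<^sub>R ((1/t) *\<^sub>R y - f x)" using t by (simp add: f.scaleR algebra_simps)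
    then have "norm (y - f (t *\<^sub>R x)) = t * norm ((1/t) *\<^sub>R y - f x)" using t by simp
    also have "\<dots> \<le> t * (r/4)" using x t by simp
    also have "\<dots> = norm y / 2" using r by (simp add: t_def)
    finally have "norm (y - f (t *\<^sub>R x)) \<le> norm y / 2" .
    moreover have "norm (t *\<^sub>R x) \<le> K * norm y"
    proof -
      have "norm (t *\<^sub>R x) = t * norm x" using t by simp
      also have "\<dots> \<le> t * (2 * n)" using x t by simp
      also have "\<dots> = K * norm y" by (simp add: t_def K_def)
      finally show ?thesis .
    qed
    ultimately show ?thesis by blast
  qed
  define g where "g y = (SOME x. norm x \<le> K * norm y \<and> norm (y - f x) \<le> norm y / 2)" for y
  have g: "norm (g y) \<le> K * norm y" "norm (y - f (g y)) \<le> norm y / 2" if "y \<in> Y" for y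
    using someI_ex[OF step[OF that]] unfolding g_def by auto
  have "\<exists>x. f x = y \<and> norm x \<le> (2 * K + 1) * norm y" if y: "y \<in> range f" for y
  proof -
    define z where "z k = ((\<lambda>w. w - f (g w)) ^^ k) y" for k
    have zS: "z (Suc k) = z k - f (g (z k))" for k by (simp add: z_def)
    have zY: "z k \<in> Y" for k
    proof (induction k)
      case 0 then show ?case using y by (simp add: z_def Y_def)
    next
      case (Suc k) then show ?case unfolding zS using subspace_diff[OF Y] Y_def by blast
    qed
    have zn: "norm (z k) \<le> norm y * (1/2)^k" for k
    proof (induction k)
      case (Suc k) then show ?case using g(2)[OF zY[of k]] unfolding zS by simp
    qed (simp add: z_def)
    have xn: "norm (g (z k)) \<le> (K * norm y) * (1/2)^k" for k
      using g(1)[OF zY[of k]] mult_left_mono[OF zn[of k] K] by (simp add: algebra_simps)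
    have geo: "summable (\<lambda>k. (K * norm y) * (1/2::real)^k)"
      by (intro summable_mult summable_geometric) simp
    have sn: "summable (\<lambda>k. norm (g (z k)))"
      by (rule summable_comparison_test'[OF geo]) (use xn in auto)
    define x where "x = (\<Sum>k. g (z k))"
    have "norm x \<le> (\<Sum>k. norm (g (z k)))" unfolding x_def by (rule summable_norm[OF sn])
    also have "\<dots> \<le> (\<Sum>k. (K * norm y) * (1/2::real)^k)" by (rule suminf_le[OF xn sn geo])
    also have "\<dots> = 2 * K * norm y" by (subst suminf_mult) (auto simp: suminf_geometric)
    also have "\<dots> \<le> (2 * K + 1) * norm y" by (simp add: algebra_simps)
    finally have nx: "norm x \<le> (2 * K + 1) * norm y" .
    have part: "(\<Sum>k<m. f (g (z k))) = y - z m" for m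
    proof (induction m)
      case 0 then show ?case by (simp add: z_def)
    next
      case (Suc m) then show ?case by (simp add: zS)
    qed
    have "z \<longlonglongrightarrow> 0"
    proof (rule Lim_null_comparison)
      show "\<forall>\<^sub>F k in sequentially. norm (z k) \<le> norm y * (1/2)^k" using zn by simp
      show "(\<lambda>k. norm y * (1/2::real)^k) \<longlonglongrightarrow> 0"
        by (intro tendsto_mult_right_zero LIMSEQ_power_zero) simp
    qed
    then have "(\<lambda>m. \<Sum>k<m. f (g (z k))) \<longlonglongrightarrow> y"
      unfolding part using tendsto_diff[of "\<lambda>_. y" y sequentially z 0] by simp
    then have "(\<lambda>k. f (g (z k))) sums y" by (simp add: sums_def)
    moreover have "(\<lambda>k. f (g (z k))) sums f x"
      unfolding x_def by (intro f.sums summable_sums summable_norm_cancel[OF sn])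
    ultimately have "f x = y" using sums_unique2 by blast
    then show ?thesis using nx by blast
  qed
  moreover have "2 * K + 1 > 0" using K by simp
  ultimately show ?thesis using that by blast
qed

text \<open>
  A partial functional is given by its graph, a subspace of the product with the reals; Zorn's
  lemma is applied to such subspaces. The bound \<open>r \<le> C * norm x\<close> makes a subspace the graph of a
  function, because at \<open>x = 0\<close> it forces both \<open>r \<le> 0\<close> and \<open>- r \<le> 0\<close>.
\<close>

lemma hahn_banach_norm:
  fixes G0 :: "('a::real_normed_vector \<times> real) set"
  assumes sub: "subspace G0" and C: "C \<ge> 0" and dom: "\<And>x r. (x, r) \<in> G0 \<Longrightarrow> r \<le> C * norm x"
  obtains \<phi> :: "'a \<Rightarrow>\<^sub>L real" where "norm \<phi> \<le> C" "\<And>x r. (x, r) \<in> G0 \<Longrightarrow> \<phi> x = r"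
proof -
  define \<A> where "\<A> = {G. subspace G \<and> G0 \<subseteq> G \<and> (\<forall>(x, r) \<in> G. r \<le> C * norm x)}"
  have "\<exists>M\<in>\<A>. \<forall>X\<in>\<A>. M \<subseteq> X \<longrightarrow> X = M"
  proof (rule subset_Zorn_nonempty)
    show "\<A> \<noteq> {}" using sub dom unfolding \<A>_def by blast
    fix \<C> assume ne: "\<C> \<noteq> {}" and ch: "subset.chain \<A> \<C>"
    have CA: "\<C> \<subseteq> \<A>" and lin: "\<And>X Y. X \<in> \<C> \<Longrightarrow> Y \<in> \<C> \<Longrightarrow> X \<subseteq> Y \<or> Y \<subseteq> X"
      using ch unfolding subset_chain_def by auto
    have "subspace (\<Union>\<C>)"
    proof (rule subspaceI)
      show "0 \<in> \<Union>\<C>" using ne CA subspace_0 unfolding \<A>_def by blast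
    next
      fix x y assume "x \<in> \<Union>\<C>" "y \<in> \<Union>\<C>"
      then obtain X Y where XY: "X \<in> \<C>" "Y \<in> \<C>" "x \<in> X" "y \<in> Y" by blast
      then obtain Z where "Z \<in> \<C>" "x \<in> Z" "y \<in> Z" using lin[OF XY(1,2)] by blast
      then show "x + y \<in> \<Union>\<C>" using CA subspace_add unfolding \<A>_def by blast
    next
      fix c x assume "x \<in> \<Union>\<C>"
      then show "c *\<^sub>R x \<in> \<Union>\<C>" using CA subspace_scale unfolding \<A>_def by blast
    qed
    then show "\<Union>\<C> \<in> \<A>" using ne CA unfolding \<A>_def by blast
  qed
  then obtain M where MA: "M \<in> \<A>" and max: "\<forall>X\<in>\<A>. M \<subseteq> X \<longrightarrow> X = M"
    by (elim bexE)
  have M: "subspace M" "G0 \<subseteq> M" "\<And>x r. (x, r) \<in> M \<Longrightarrow> r \<le> C * norm x"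
    using MA unfolding \<A>_def by auto
  have uniq: "r = s" if "(x, r) \<in> M" "(x, s) \<in> M" for x r s
  proof -
    have "(0, r - s) \<in> M" "(0, s - r) \<in> M"
      using subspace_diff[OF M(1) that] subspace_diff[OF M(1) that(2,1)] by (simp_all only: diff_Pair diff_self)
    from this[THEN M(3)] show ?thesis by simp
  qed
  have total: "\<exists>r. (x0, r) \<in> M" for x0
  proof (rule ccontr)
    assume no: "\<nexists>r. (x0, r) \<in> M"
    \<comment> \<open>A value \<open>c\<close> at \<open>x0\<close> keeps the bound iff it lies above \<open>L\<close> and below the expressions
      \<open>C * norm (y + x0) - s\<close>.\<close>
    define L where "L = {r - C * norm (x - x0) |x r. (x, r) \<in> M}"
    have le: "r - C * norm (x - x0) \<le> C * norm (y + x0) - s" if "(x, r) \<in> M" "(y, s) \<in> M" for x r y s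
    proof -
      have "r + s \<le> C * norm (x + y)" using M(3)[of "x + y" "r + s"] subspace_add[OF M(1) that] by simp
      also have "norm (x + y) \<le> norm (x - x0) + norm (y + x0)"
        using norm_triangle_ineq[of "x - x0" "y + x0"] by (simp add: algebra_simps)
      then have "C * norm (x + y) \<le> C * norm (x - x0) + C * norm (y + x0)"
        using C by (metis distrib_left mult_left_mono)
      finally show ?thesis by linarith
    qed
    have 0: "(0, 0) \<in> M" using subspace_0[OF M(1)] by (simp add: zero_prod_def)
    have Lne: "L \<noteq> {}" unfolding L_def using 0 by blast
    have Lbd: "bdd_above L" unfolding L_def using le[OF _ 0] by (intro bdd_aboveI) blast
    define c where "c = Sup L"
    have c1: "r - C * norm (x - x0) \<le> c" if "(x, r) \<in> M" for x r
      unfolding c_def by (rule cSup_upper[OF _ Lbd]) (use that L_def in blast)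
    have c2: "c \<le> C * norm (y + x0) - s" if "(y, s) \<in> M" for y s
      unfolding c_def by (rule cSup_least[OF Lne]) (use that le L_def in blast)
    define M' where "M' = {(x + t *\<^sub>R x0, r + t * c) |x r t. (x, r) \<in> M}"
    have "M' \<in> \<A>"
      unfolding \<A>_def
    proof (intro CollectI conjI)
      have "M' = {u + v |u v. u \<in> M \<and> v \<in> span {(x0, c)}}"
        unfolding M'_def span_singleton by (force simp: scaleR_prod_def)
      then show "subspace M'" using subspace_sums[OF M(1) subspace_span] by simp
      have "M \<subseteq> M'" unfolding M'_def by (force intro: exI[of _ 0])
      then show "G0 \<subseteq> M'" using M(2) by blast
      show "\<forall>(x, r) \<in> M'. r \<le> C * norm x"
      proof clarify
        fix z w assume "(z, w) \<in> M'"
        then obtain x r t where *: "z = x + t *\<^sub>R x0" "w = r + t * c" "(x, r) \<in> M"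
          unfolding M'_def by blast
        consider "t = 0" | "t > 0" | "t < 0" by linarith
        then show "w \<le> C * norm z"
        proof cases
          case 1 then show ?thesis using * M(3) by simp
        next
          case 2
          have "((1/t) *\<^sub>R x, (1/t) * r) \<in> M" using subspace_scale[OF M(1) *(3), of "1/t"] by (simp add: scaleR_prod_def)
          then have "t * c \<le> t * (C * norm ((1/t) *\<^sub>R x + x0) - (1/t) * r)"
            using c2 2 by (intro mult_left_mono) auto
          also have "\<dots> = C * (t * norm ((1/t) *\<^sub>R x + x0)) - r" using 2 by (simp add: algebra_simps)
          also have "t * norm ((1/t) *\<^sub>R x + x0) = norm (t *\<^sub>R ((1/t) *\<^sub>R x + x0))" using 2 by simp
          also have "t *\<^sub>R ((1/t) *\<^sub>R x + x0) = z" using 2 * by (simp add: algebra_simps)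
          finally show ?thesis using * by simp
        next
          case 3
          define u where "u = - t"
          have u: "u > 0" "t = - u" using 3 by (auto simp: u_def)
          have "((1/u) *\<^sub>R x, (1/u) * r) \<in> M" using subspace_scale[OF M(1) *(3), of "1/u"] by (simp add: scaleR_prod_def)
          then have "u * ((1/u) * r - C * norm ((1/u) *\<^sub>R x - x0)) \<le> u * c"
            using c1 u by (intro mult_left_mono) auto
          also have "u * ((1/u) * r - C * norm ((1/u) *\<^sub>R x - x0)) = r - C * (u * norm ((1/u) *\<^sub>R x - x0))"
            using u by (simp add: algebra_simps)
          also have "u * norm ((1/u) *\<^sub>R x - x0) = norm (u *\<^sub>R ((1/u) *\<^sub>R x - x0))" using u by simp
          also have "u *\<^sub>R ((1/u) *\<^sub>R x - x0) = z" using u * by (simp add: algebra_simps)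
          finally show ?thesis using * u by simp
        qed
      qed
    qed
    moreover have "M \<subseteq> M'" unfolding M'_def by (force intro: exI[of _ 0])
    ultimately have "M' = M" using max by blast
    moreover have "(x0, c) \<in> M'" unfolding M'_def using 0 by (force intro: exI[of _ 1])
    ultimately show False using no by blast
  qed
  define \<phi> where "\<phi> x = (THE r. (x, r) \<in> M)" for x
  have \<phi>M: "(x, \<phi> x) \<in> M" for x
    unfolding \<phi>_def using total uniq by (metis the_equality)
  have \<phi>I: "\<phi> x = r" if "(x, r) \<in> M" for x r using uniq \<phi>M that by blast
  have bd: "norm (\<phi> x) \<le> C * norm x" for x
    using M(3)[OF \<phi>M[of x]] M(3)[of "- x" "- \<phi> x"] subspace_neg[OF M(1) \<phi>M[of x]] by simp
  have "bounded_linear \<phi>"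
  proof (rule bounded_linear_intro)
    show "\<phi> (x + y) = \<phi> x + \<phi> y" for x y
      by (rule \<phi>I) (use subspace_add[OF M(1) \<phi>M[of x] \<phi>M[of y]] in simp)
    show "\<phi> (r *\<^sub>R x) = r *\<^sub>R \<phi> x" for r x
      by (rule \<phi>I) (use subspace_scale[OF M(1) \<phi>M[of x], of r] in \<open>simp add: scaleR_prod_def\<close>)
    show "norm (\<phi> x) \<le> norm x * C" for x using bd[of x] by (simp add: mult.commute)
  qed
  then have ap: "blinfun_apply (Blinfun \<phi>) = \<phi>" by (rule bounded_linear_Blinfun_apply)
  show ?thesis
  proof (rule that[of "Blinfun \<phi>"])
    show "norm (Blinfun \<phi>) \<le> C" by (rule norm_blinfun_bound) (use C bd ap in auto)
    show "Blinfun \<phi> x = r" if "(x, r) \<in> G0" for x r using ap \<phi>I M(2) that by auto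
  qed
qed

text \<open>
  The functionals of norm at most 1 are exactly the linear functions in the compact product of the
  intervals \<open>{- norm x..norm x}\<close>, and linearity is preserved by pointwise limits.
\<close>

lemma banach_alaoglu:
  "compactin (strong_operator_topology :: ('v::real_normed_vector \<Rightarrow>\<^sub>L real) topology) (cball 0 1)"
proof -
  define K where "K = (\<Pi>\<^sub>E x\<in>(UNIV :: 'v set). {- norm x..norm x})"
  define L where "L = {f \<in> K. linear f}"
  have "compactin (product_topology (\<lambda>_. euclideanreal) UNIV) K"
    unfolding K_def by (subst compactin_PiE) (auto simp: compact_Icc)
  then have "compact K" by (simp add: euclidean_product_topology)
  moreover have "closed {f :: 'v \<Rightarrow> real. linear f}"
  proof -
    have "closed {f :: 'v \<Rightarrow> real. \<forall>x y. f (x + y) = f x + f y}"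
      by (intro closed_Collect_all closed_Collect_eq continuous_on_product_coordinates continuous_on_add)
    moreover have "closed {f :: 'v \<Rightarrow> real. \<forall>r x. f (r *\<^sub>R x) = r *\<^sub>R f x}"
      by (intro closed_Collect_all closed_Collect_eq continuous_on_product_coordinates continuous_on_scaleR continuous_on_const)
    ultimately have "closed ({f :: 'v \<Rightarrow> real. \<forall>x y. f (x + y) = f x + f y} \<inter> {f. \<forall>r x. f (r *\<^sub>R x) = r *\<^sub>R f x})"
      by (rule closed_Int)
    moreover have "{f :: 'v \<Rightarrow> real. \<forall>x y. f (x + y) = f x + f y} \<inter> {f. \<forall>r x. f (r *\<^sub>R x) = r *\<^sub>R f x} = {f. linear f}"
      by (auto simp: linear_iff)
    ultimately show ?thesis by simp
  qed
  ultimately have "compact (K \<inter> {f. linear f})" by (rule compact_Int_closed)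
  then have L: "compactin (euclidean :: ('v \<Rightarrow> real) topology) L"
    by (simp add: L_def Int_def)
  have bound: "\<bar>f x\<bar> \<le> norm x" if "f \<in> L" for f x
    using that by (auto simp: L_def K_def PiE_iff abs_le_iff minus_le_iff)
  have ap: "blinfun_apply (Blinfun f) = f" if "f \<in> L" for f
  proof (rule bounded_linear_Blinfun_apply)
    show "bounded_linear f"
    proof (rule bounded_linear.intro)
      show "linear f" using that by (simp add: L_def)
      show "bounded_linear_axioms f"
        by (rule bounded_linear_axioms.intro) (use bound[OF that] in \<open>auto intro!: exI[of _ 1]\<close>)
    qed
  qed
  have "continuous_map (subtopology euclidean L) strong_operator_topology Blinfun"
    by (auto simp: continuous_on_strong_operator_topo_iff_coordinatewise ap
      intro!: continuous_map_eq[where f = "\<lambda>f. f _"] continuous_on_subset[OF continuous_on_product_coordinates])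
  then have "compactin strong_operator_topology (Blinfun ` L)"
    using L by (intro image_compactin) (auto simp: compactin_subtopology)
  moreover have "Blinfun ` L = cball 0 1"
  proof
    show "Blinfun ` L \<subseteq> cball 0 1"
    proof clarify
      fix f assume f: "f \<in> L"
      have "norm (Blinfun f) \<le> 1"
        by (rule norm_blinfun_bound) (use ap[OF f] bound[OF f] in auto)
      then show "Blinfun f \<in> cball 0 1" by simp
    qed
    show "cball 0 1 \<subseteq> Blinfun ` L"
    proof
      fix \<nu> :: "'v \<Rightarrow>\<^sub>L real" assume "\<nu> \<in> cball 0 1"
      then have "norm \<nu> \<le> 1" by simp
      then have "\<bar>\<nu> x\<bar> \<le> norm x" for x
        using norm_blinfun[of \<nu> x] mult_right_mono[of "norm \<nu>" 1 "norm x"] by simp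
      then have "blinfun_apply \<nu> \<in> L"
        by (auto simp: L_def K_def abs_le_iff minus_le_iff bounded_linear.linear blinfun.bounded_linear_right)
      moreover have "Blinfun (blinfun_apply \<nu>) = \<nu>" by (rule blinfun_apply_inverse)
      ultimately show "\<nu> \<in> Blinfun ` L" by (metis imageI)
    qed
  qed
  ultimately show ?thesis by simp
qed

section \<open>Selection by Martin's axiom\<close>

lemma martin_axiom_lepoll:
  fixes I :: "'i set" and J :: "'j set"
  assumes MA: "martin_axiom TYPE('p) I" and JI: "J \<lesssim> I"
  shows "martin_axiom TYPE('p) J"
  unfolding martin_axiom_def
proof (intro allI impI, elim conjE)
  fix P :: "'p set" and le :: "'p rel" and D :: "'j \<Rightarrow> 'p set"
  assume P: "P \<noteq> {}" "partial_order_on P le" "ccc P le" and D: "\<forall>\<xi>\<in>J. dense_in_poset P le (D \<xi>)"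
  obtain f where f: "inj_on f J" "f ` J \<subseteq> I" using JI unfolding lepoll_def by blast
  define D' where "D' \<xi> = (if \<xi> \<in> f ` J then D (inv_into J f \<xi>) else P)" for \<xi>
  have "dense_in_poset P le P"
    using P(2) unfolding dense_in_poset_def partial_order_on_def preorder_on_def refl_on_def by blast
  then have "\<forall>\<xi>\<in>I. dense_in_poset P le (D' \<xi>)"
    using D inv_into_into[of _ f J] unfolding D'_def by auto
  then obtain G where G: "directed_in_poset P le G" "\<forall>\<xi>\<in>I. G \<inter> D' \<xi> \<noteq> {}"
    using MA[unfolded martin_axiom_def, rule_format, of P le D'] P by meson
  have "G \<inter> D \<xi> \<noteq> {}" if "\<xi> \<in> J" for \<xi>
  proof -
    have "D' (f \<xi>) = D \<xi>" using that f(1) by (simp add: D'_def)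
    then show ?thesis using G(2) f(2) that by blast
  qed
  then show "\<exists>G. directed_in_poset P le G \<and> (\<forall>\<xi>\<in>J. G \<inter> D \<xi> \<noteq> {})" using G(1) by blast
qed

text \<open>
  This is the Rasiowa-Sikorski lemma: an increasing sequence meets the dense sets one by one.
\<close>

lemma martin_axiom_countable:
  fixes J :: "'j set"
  assumes J: "countable J"
  shows "martin_axiom TYPE('p) J"
  unfolding martin_axiom_def
proof (intro allI impI, elim conjE)
  fix P :: "'p set" and le :: "'p rel" and D :: "'j \<Rightarrow> 'p set"
  assume P: "P \<noteq> {}" "partial_order_on P le" and D: "\<forall>\<xi>\<in>J. dense_in_poset P le (D \<xi>)"
  obtain p0 where p0: "p0 \<in> P" using P(1) by blast
  have refl: "(a, a) \<in> le" if "a \<in> P" for a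
    using P(2) that unfolding partial_order_on_def preorder_on_def refl_on_def by blast
  have tr: "trans le" using P(2) unfolding partial_order_on_def preorder_on_def by blast
  show "\<exists>G. directed_in_poset P le G \<and> (\<forall>\<xi>\<in>J. G \<inter> D \<xi> \<noteq> {})"
  proof (cases "J = {}")
    case True
    have "directed_in_poset P le {p0}" unfolding directed_in_poset_def using p0 refl by blast
    then show ?thesis using True by blast
  next
    case False
    define e where "e = from_nat_into J"
    have e: "range e = J" unfolding e_def by (rule range_from_nat_into[OF False J])
    have ex: "\<exists>d. d \<in> D (e n) \<and> d \<in> P \<and> (p, d) \<in> le" if "p \<in> P" for p n
    proof -
      have "dense_in_poset P le (D (e n))" using D e by blast
      then show ?thesis using that unfolding dense_in_poset_def by blast
    qed
    define x where "x = rec_nat p0 (\<lambda>n p. SOME d. d \<in> D (e n) \<and> d \<in> P \<and> (p, d) \<in> le)"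
    have xS: "x (Suc n) = (SOME d. d \<in> D (e n) \<and> d \<in> P \<and> (x n, d) \<in> le)" for n
      by (simp add: x_def)
    have xP: "x n \<in> P" for n
    proof (induction n)
      case (Suc n)
      then show ?case using someI_ex[OF ex[OF Suc.IH, of n]] unfolding xS by blast
    qed (simp add: x_def p0)
    have step: "x (Suc n) \<in> D (e n)" "(x n, x (Suc n)) \<in> le" for n
      using someI_ex[OF ex[OF xP[of n], of n]] unfolding xS by auto
    have mono: "(x m, x n) \<in> le" if "m \<le> n" for m n
      using that
    proof (induction n rule: dec_induct)
      case base then show ?case using refl xP by blast
    next
      case (step n) then show ?case using transD[OF tr] \<open>\<And>n. (x n, x (Suc n)) \<in> le\<close> by blast
    qed
    have "directed_in_poset P le (range x)"
      unfolding directed_in_poset_def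
    proof (intro conjI ballI)
      show "range x \<subseteq> P" using xP by blast
      fix a b assume "a \<in> range x" "b \<in> range x"
      then obtain m n where "a = x m" "b = x n" by (elim rangeE)
      then show "\<exists>q\<in>range x. (a, q) \<in> le \<and> (b, q) \<in> le"
        using mono[of m "max m n"] mono[of n "max m n"] by auto
    qed
    moreover have "range x \<inter> D \<xi> \<noteq> {}" if "\<xi> \<in> J" for \<xi>
    proof -
      have "\<xi> \<in> range e" using that e by simp
      then obtain n where "\<xi> = e n" by (elim rangeE)
      then show ?thesis using step(1)[of n] by blast
    qed
    ultimately show ?thesis by blast
  qed
qed

text \<open>
  Countably many further dense sets come for free: an infinite \<open>I\<close> absorbs them, and for a finite
  \<open>I\<close> there are only countably many dense sets altogether.
\<close>

lemma martin_axiom_Plus_nat: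
  fixes I :: "'i set"
  assumes "martin_axiom TYPE('p) I"
  shows "martin_axiom TYPE('p) (I <+> (UNIV :: nat set))"
proof (cases "finite I")
  case True
  then show ?thesis by (intro martin_axiom_countable countable_Plus) (auto intro: countable_finite)
next
  case False
  then have "(card_of (UNIV :: nat set), card_of I) \<in> ordLeq"
    by (simp add: infinite_iff_card_of_nat)
  then have "(card_of (I <+> (UNIV :: nat set)), card_of I) \<in> ordIso" by (rule card_of_Plus_infinite1[OF False])
  then have "I <+> (UNIV :: nat set) \<lesssim> I"
    unfolding lepoll_def card_of_ordLeq by (rule ordIso_imp_ordLeq)
  then show ?thesis by (rule martin_axiom_lepoll[OF assms])
qed

lemma countable_finite_maps:
  fixes N :: "'n set" and D :: "'d set"
  assumes N: "countable N" and D: "countable D"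
  shows "countable {s. finite (dom s) \<and> dom s \<subseteq> N \<and> ran s \<subseteq> D}" (is "countable ?S")
proof (rule countable_image_inj_on)
  show "inj_on Map.graph ?S"
    by (rule inj_onI) (metis graph_domD in_graphD in_graphI map_le_antisym map_le_def domD)
  have "Map.graph ` ?S \<subseteq> {X. finite X \<and> X \<subseteq> N \<times> D}"
    by (auto simp: graph_eq_to_snd_dom ran_def intro: finite_subset)
  then show "countable (Map.graph ` ?S)"
    using countable_Collect_finite_subset[OF countable_SIGMA[OF N D]] countable_subset by blast
qed

text \<open>
  An abstract form of the forcing argument. For each \<open>n\<close> a value in \<open>D\<close> is to be selected, and
  \<open>P F n\<close> consists of the values that satisfy the finitely many requirements \<open>F\<close>. A condition is a
  finite part \<open>s\<close> of the selection together with a finite set \<open>F\<close> of requirements, which bind all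
  values selected later. The predicate \<open>V\<close> says that \<open>F\<close> is feasible at \<open>n\<close>; a condition promises
  feasibility outside the domain of \<open>s\<close>, so that it never obstructs a value still to be selected.

  Enlarging \<open>F\<close> makes only finitely many further \<open>n\<close> infeasible, and there the values must be
  selected before the enlargement. This is also how two conditions with the same \<open>s\<close> are joined, and
  at these \<open>n\<close> their requirements are feasible separately but perhaps not together. The assumption
  \<open>linked\<close> bridges this gap: pairwise feasibility suffices for a common value in \<open>P\<close>. Since there are
  only countably many \<open>s\<close>, the countable chain condition follows.
\<close>

lemma martin_selection:
  fixes J :: "'j set" and N :: "'n set" and D :: "'d set"
    and V :: "'j set \<Rightarrow> 'n \<Rightarrow> bool" and P :: "'j set \<Rightarrow> 'n \<Rightarrow> 'd set"
  assumes MA: "martin_axiom TYPE(('n \<rightharpoonup> 'd) \<times> 'j set) (J <+> (UNIV :: nat set))"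
    and N: "countable N" and D: "countable D"
    and Dne: "D \<noteq> {}"
    and anti: "\<And>F F' n. F \<subseteq> F' \<Longrightarrow> P F' n \<subseteq> P F n"
    and linked: "\<And>F F' n. \<lbrakk>finite F; F \<subseteq> J; finite F'; F' \<subseteq> J; n \<in> N; V F n; V F' n\<rbrakk>
        \<Longrightarrow> \<exists>d\<in>D. d \<in> P F n \<and> d \<in> P F' n"
    and cofin: "\<And>F. \<lbrakk>finite F; F \<subseteq> J\<rbrakk> \<Longrightarrow> finite {n\<in>N. \<not> V F n}"
  obtains g where "\<And>n. n \<in> N \<Longrightarrow> g n \<in> D"
    and "\<And>F. \<lbrakk>finite F; F \<subseteq> J\<rbrakk> \<Longrightarrow> finite {n\<in>N. g n \<notin> P F n}"
proof -
  define Q where "Q = {(s, F). finite (dom s) \<and> dom s \<subseteq> N \<and> ran s \<subseteq> D \<and> finite F \<and> F \<subseteq> J \<and>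
    (\<forall>n\<in>N - dom s. V F n)}"
  define le where "le = {((s, F), (s', F')). (s, F) \<in> Q \<and> (s', F') \<in> Q \<and> s \<subseteq>\<^sub>m s' \<and> F \<subseteq> F' \<and>
    (\<forall>n\<in>dom s' - dom s. the (s' n) \<in> P F n)}"
  have QI: "(s, F) \<in> Q" if "finite (dom s)" "dom s \<subseteq> N" "ran s \<subseteq> D" "finite F" "F \<subseteq> J"
    "\<And>n. n \<in> N \<Longrightarrow> n \<notin> dom s \<Longrightarrow> V F n" for s F
    using that unfolding Q_def by blast
  have QD: "finite (dom s)" "dom s \<subseteq> N" "ran s \<subseteq> D" "finite F" "F \<subseteq> J"
    "\<And>n. n \<in> N \<Longrightarrow> n \<notin> dom s \<Longrightarrow> V F n" if "(s, F) \<in> Q" for s F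
    using that unfolding Q_def by auto
  have leI: "((s, F), (s', F')) \<in> le" if "(s, F) \<in> Q" "(s', F') \<in> Q" "s \<subseteq>\<^sub>m s'" "F \<subseteq> F'"
    "\<And>n. n \<in> dom s' \<Longrightarrow> n \<notin> dom s \<Longrightarrow> the (s' n) \<in> P F n" for s F s' F'
    using that unfolding le_def by blast
  have leD: "(s, F) \<in> Q" "(s', F') \<in> Q" "s \<subseteq>\<^sub>m s'" "F \<subseteq> F'"
    "\<And>n. n \<in> dom s' \<Longrightarrow> n \<notin> dom s \<Longrightarrow> the (s' n) \<in> P F n" if "((s, F), (s', F')) \<in> le" for s F s' F'
    using that unfolding le_def by auto
  have amalgam: "\<exists>s'. A \<subseteq> dom s' \<and> ((s, F), (s', H)) \<in> le \<and> ((s, F'), (s', H)) \<in> le"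
    if p: "(s, F) \<in> Q" and p': "(s, F') \<in> Q" and H: "finite H" "H \<subseteq> J" "F \<union> F' \<subseteq> H"
      and A: "finite A" "A \<subseteq> N" for s F F' H A
  proof -
    \<comment> \<open>At the points of \<open>B\<close> a value has to be selected now: on request, or because the
      enlarged requirements \<open>H\<close> may be infeasible there.\<close>
    define B where "B = (A \<union> {n\<in>N. \<not> V H n}) - dom s"
    have B: "finite B" "B \<subseteq> N" using A cofin[OF H(1,2)] by (auto simp: B_def)
    have "\<exists>d. d \<in> D \<and> d \<in> P F n \<and> d \<in> P F' n" if "n \<in> B" for n
    proof -
      have "n \<in> N" "n \<notin> dom s" using that B(2) by (auto simp: B_def)
      then show ?thesis using linked[OF QD(4,5)[OF p] QD(4,5)[OF p']] QD(6)[OF p] QD(6)[OF p'] by blast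
    qed
    then obtain d where d: "\<And>n. n \<in> B \<Longrightarrow> d n \<in> D \<and> d n \<in> P F n \<and> d n \<in> P F' n" by metis
    define s' where "s' n = (if n \<in> B then Some (d n) else s n)" for n
    have dom: "dom s' = B \<union> dom s" by (auto simp: s'_def split: if_splits)
    have ran: "ran s' \<subseteq> D" using d QD(3)[OF p] by (auto simp: s'_def ran_def split: if_splits)
    have sub: "s \<subseteq>\<^sub>m s'" by (auto simp: map_le_def s'_def B_def)
    have new: "the (s' n) \<in> P F n \<and> the (s' n) \<in> P F' n" if "n \<in> dom s'" "n \<notin> dom s" for n
      using that d unfolding dom by (simp add: s'_def)
    have "(s', H) \<in> Q"
      by (rule QI) (use B H QD(1,2)[OF p] ran in \<open>auto simp: dom B_def\<close>)
    then have "((s, F), (s', H)) \<in> le" "((s, F'), (s', H)) \<in> le"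
      using leI[OF p _ sub] leI[OF p' _ sub] H(3) new by auto
    moreover have "A \<subseteq> dom s'" unfolding dom B_def by blast
    ultimately show ?thesis by blast
  qed
  have grow: "\<exists>s'. A \<subseteq> dom s' \<and> ((s, F), (s', H)) \<in> le"
    if "(s, F) \<in> Q" "finite H" "H \<subseteq> J" "F \<subseteq> H" "finite A" "A \<subseteq> N" for s F H A
  proof -
    have "F \<union> F \<subseteq> H" using that(4) by simp
    from amalgam[OF that(1,1-3) this that(5,6)] show ?thesis by (elim exE conjE) (rule exI, rule conjI)
  qed
  \<comment> \<open>Meeting these sets makes the selection total and puts every requirement into force.\<close>
  define X where "X \<xi> = (case \<xi> of Inl j \<Rightarrow> {(s, F) \<in> Q. j \<in> F}
       | Inr k \<Rightarrow> {(s, F) \<in> Q. \<forall>n\<in>N. to_nat_on N n = k \<longrightarrow> n \<in> dom s})" for \<xi> :: "'j + nat"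
  obtain s0 :: "'n \<rightharpoonup> 'd" where s0: "(s0, {}) \<in> Q"
  proof -
    obtain d where d: "d \<in> D" using Dne by blast
    define s0 :: "'n \<rightharpoonup> 'd" where "s0 n = (if n \<in> N \<and> \<not> V {} n then Some d else None)" for n
    have dom: "dom s0 = {n\<in>N. \<not> V {} n}" by (auto simp: s0_def split: if_splits)
    have "(s0, {}) \<in> Q"
    proof (rule QI)
      show "ran s0 \<subseteq> D" using d by (auto simp: s0_def ran_def split: if_splits)
    qed (use cofin[of "{}"] in \<open>auto simp: dom\<close>)
    then show ?thesis by (rule that)
  qed
  have "\<exists>G. directed_in_poset Q le G \<and> (\<forall>\<xi>\<in>J <+> UNIV. G \<inter> X \<xi> \<noteq> {})"
  proof (rule MA[unfolded martin_axiom_def, rule_format], intro conjI ballI)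
    show "Q \<noteq> {}" using s0 by blast
    show "partial_order_on Q le"
      unfolding partial_order_on_def preorder_on_def
    proof (intro conjI)
      show "le \<subseteq> Q \<times> Q" unfolding le_def by blast
      show "refl_on Q le"
        unfolding refl_on_def using leI by (auto simp: map_le_def)
      show "antisym le"
      proof (rule antisymI)
        fix x y assume xy: "(x, y) \<in> le" "(y, x) \<in> le"
        obtain s F t H where [simp]: "x = (s, F)" "y = (t, H)" by (metis surj_pair)
        have "((s, F), (t, H)) \<in> le" "((t, H), (s, F)) \<in> le" using xy by auto
        then have "s \<subseteq>\<^sub>m t" "t \<subseteq>\<^sub>m s" "F \<subseteq> H" "H \<subseteq> F" using leD(3,4) by blast+
        then show "x = y" using map_le_antisym by auto
      qed
      show "trans le"
      proof (rule transI)
        fix x y z assume "(x, y) \<in> le" "(y, z) \<in> le"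
        moreover obtain s F t G u H where [simp]: "x = (s, F)" "y = (t, G)" "z = (u, H)"
          by (metis surj_pair)
        ultimately have a: "((s, F), (t, G)) \<in> le" and b: "((t, G), (u, H)) \<in> le" by auto
        have "((s, F), (u, H)) \<in> le"
        proof (rule leI[OF leD(1)[OF a] leD(2)[OF b]])
          show "s \<subseteq>\<^sub>m u" using map_le_trans leD(3)[OF a] leD(3)[OF b] by blast
          show "F \<subseteq> H" using leD(4)[OF a] leD(4)[OF b] by blast
          fix n assume n: "n \<in> dom u" "n \<notin> dom s"
          show "the (u n) \<in> P F n"
          proof (cases "n \<in> dom t")
            case True
            then have "u n = t n" using leD(3)[OF b] by (simp add: map_le_def)
            then show ?thesis using leD(5)[OF a True n(2)] by simp
          next
            case False
            then show ?thesis using leD(5)[OF b n(1)] anti[OF leD(4)[OF a]] by blast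
          qed
        qed
        then show "(x, z) \<in> le" by simp
      qed
    qed
    show "ccc Q le"
      unfolding ccc_def
    proof (intro allI impI)
      fix A assume A: "A \<subseteq> Q" "uncountable A"
      have "fst ` A \<subseteq> {s. finite (dom s) \<and> dom s \<subseteq> N \<and> ran s \<subseteq> D}"
        using A(1) QD(1-3) by fastforce
      then have "countable (fst ` A)" using countable_finite_maps[OF N D] countable_subset by blast
      then have "\<not> inj_on fst A" using A(2) countable_image_inj_on by blast
      then obtain p p' where pp: "p \<in> A" "p' \<in> A" "p \<noteq> p'" "fst p = fst p'"
        unfolding inj_on_def by blast
      then obtain s F F' where [simp]: "p = (s, F)" "p' = (s, F')" by (metis prod.collapse)
      have Q: "(s, F) \<in> Q" "(s, F') \<in> Q" using pp A(1) by auto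
      obtain s' where "((s, F), (s', F \<union> F')) \<in> le" "((s, F'), (s', F \<union> F')) \<in> le"
        using amalgam[OF Q, of "F \<union> F'" "{}"] QD(4,5)[OF Q(1)] QD(4,5)[OF Q(2)] by auto
      then show "\<exists>p\<^sub>1\<in>A. \<exists>p\<^sub>2\<in>A. p\<^sub>1 \<noteq> p\<^sub>2 \<and> (\<exists>q\<in>Q. (p\<^sub>1, q) \<in> le \<and> (p\<^sub>2, q) \<in> le)"
        using pp leD(2) by (intro bexI[of _ p] bexI[of _ p'] conjI bexI[of _ "(s', F \<union> F')"]) auto
    qed
    fix \<xi> assume \<xi>: "\<xi> \<in> J <+> (UNIV :: nat set)"
    show "dense_in_poset Q le (X \<xi>)"
    proof (cases \<xi>)
      case (Inl j)
      then have j: "j \<in> J" using \<xi> by auto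
      have "\<exists>d\<in>{(s, F) \<in> Q. j \<in> F}. (p, d) \<in> le" if pQ: "p \<in> Q" for p
      proof -
        obtain s F where p: "p = (s, F)" by (metis surj_pair)
        obtain s' where "((s, F), (s', insert j F)) \<in> le"
          using grow[of s F "insert j F" "{}"] pQ QD(4,5)[of s F] j p by (auto simp: subset_insertI)
        then show ?thesis using leD(2) p by (intro bexI[of _ "(s', insert j F)"]) auto
      qed
      then show ?thesis unfolding dense_in_poset_def X_def Inl by auto
    next
      case (Inr k)
      have "\<exists>d\<in>{(s, F) \<in> Q. \<forall>n\<in>N. to_nat_on N n = k \<longrightarrow> n \<in> dom s}. (p, d) \<in> le" if pQ: "p \<in> Q" for p
      proof -
        obtain s F where p: "p = (s, F)" by (metis surj_pair)
        define A where "A = {n\<in>N. to_nat_on N n = k}"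
        have "finite A"
        proof (rule finite_subset)
          show "A \<subseteq> {from_nat_into N k}" unfolding A_def using from_nat_into_to_nat_on[OF N] by auto
        qed simp
        then obtain s' where "A \<subseteq> dom s'" "((s, F), (s', F)) \<in> le"
          using grow[of s F F A] pQ QD(4,5)[of s F] p A_def by auto
        then show ?thesis using leD(2) p by (intro bexI[of _ "(s', F)"]) (auto simp: A_def)
      qed
      then show ?thesis unfolding dense_in_poset_def X_def Inr by auto
    qed
  qed
  then obtain G where dir: "directed_in_poset Q le G" and GX: "\<And>\<xi>. \<xi> \<in> J <+> UNIV \<Longrightarrow> G \<inter> X \<xi> \<noteq> {}"
    by blast
  have GQ: "G \<subseteq> Q" using dir unfolding directed_in_poset_def by blast
  have ub: "\<exists>r\<in>G. (p, r) \<in> le \<and> (q, r) \<in> le" if "p \<in> G" "q \<in> G" for p q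
    using dir that unfolding directed_in_poset_def by blast
  define g where "g n = (SOME d. \<exists>s F. (s, F) \<in> G \<and> s n = Some d)" for n
  have cover: "\<exists>s F. (s, F) \<in> G \<and> n \<in> dom s" if "n \<in> N" for n
  proof -
    obtain p where "p \<in> G" "p \<in> X (Inr (to_nat_on N n))" using GX[of "Inr (to_nat_on N n)"] by blast
    then show ?thesis using that unfolding X_def by auto
  qed
  have g: "s n = Some (g n)" if sG: "(s, F) \<in> G" and sn: "n \<in> dom s" for s F n
  proof -
    \<comment> \<open>Two conditions in \<open>G\<close> have an upper bound that extends both, so they select the same value.\<close>
    have "\<exists>d s F. (s, F) \<in> G \<and> s n = Some d" using sG sn by blast
    from someI_ex[OF this] obtain t H where t: "(t, H) \<in> G" "t n = Some (g n)" unfolding g_def by blast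
    obtain u K where "((s, F), (u, K)) \<in> le" "((t, H), (u, K)) \<in> le" using ub[OF sG t(1)] by auto
    then have "s \<subseteq>\<^sub>m u" "t \<subseteq>\<^sub>m u" using leD(3) by blast+
    then have "s n = u n" "t n = u n" using sn t(2) unfolding map_le_def by blast+
    then show ?thesis using t(2) by simp
  qed
  have gD: "g n \<in> D" if n: "n \<in> N" for n
  proof -
    obtain s F where s: "(s, F) \<in> G" "n \<in> dom s" using cover[OF n] by blast
    then have "g n \<in> ran s" using g[OF s] by (intro ranI)
    then show ?thesis using QD(3)[of s F] s(1) GQ by blast
  qed
  have step: "g n \<in> P F n" if p: "(s, F) \<in> G" and n: "n \<in> N" "n \<notin> dom s" for s F n
  proof -
    obtain t H where t: "(t, H) \<in> G" "n \<in> dom t" using cover[OF n(1)] by blast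
    obtain u K where u: "(u, K) \<in> G" "((s, F), (u, K)) \<in> le" "((t, H), (u, K)) \<in> le"
      using ub[OF p t(1)] by auto
    have nu: "n \<in> dom u" using map_le_implies_dom_le[OF leD(3)[OF u(3)]] t(2) by blast
    have "the (u n) \<in> P F n" by (rule leD(5)[OF u(2) nu n(2)])
    then show ?thesis using g[OF u(1) nu] by simp
  qed
  have large: "\<exists>s F'. (s, F') \<in> G \<and> F \<subseteq> F'" if "finite F" "F \<subseteq> J" for F
    using that
  proof (induction F)
    case empty
    obtain p where "p \<in> G" using GX[of "Inr 0"] by blast
    then show ?case by (cases p) auto
  next
    case (insert j F)
    then obtain s F1 where 1: "(s, F1) \<in> G" "F \<subseteq> F1" by blast
    have "j \<in> J" using insert by blast
    then obtain q where "q \<in> G" "q \<in> X (Inl j)" using GX[of "Inl j"] by blast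
    then obtain t F2 where 2: "(t, F2) \<in> G" "j \<in> F2" unfolding X_def by auto
    obtain u F3 where 3: "(u, F3) \<in> G" "((s, F1), (u, F3)) \<in> le" "((t, F2), (u, F3)) \<in> le"
      using ub[OF 1(1) 2(1)] by auto
    then have "insert j F \<subseteq> F3" using leD(4)[OF 3(2)] leD(4)[OF 3(3)] 1 2 by blast
    then show ?case using 3(1) by blast
  qed
  show ?thesis
  proof (rule that[of g])
    show "g n \<in> D" if "n \<in> N" for n by (rule gD[OF that])
    show "finite {n\<in>N. g n \<notin> P F n}" if F: "finite F" "F \<subseteq> J" for F
    proof -
      obtain s F' where s: "(s, F') \<in> G" "F \<subseteq> F'" using large[OF F] by blast
      have "{n\<in>N. g n \<notin> P F n} \<subseteq> dom s" using step[OF s(1)] anti[OF s(2)] by blast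
      then show ?thesis using QD(1)[of s F'] s(1) GQ finite_subset by blast
    qed
  qed
qed

section \<open>Functionals on the continuous functions on a cube\<close>

text \<open>
  The value is meaningful for a set that is both open and closed; only then is its indicator
  function continuous.
\<close>

definition indicator_C :: "'a::topological_space set \<Rightarrow> 'a \<Rightarrow>\<^sub>C real" where
  "indicator_C A = Bcontfun (indicator A)"

lemma indicator_C_apply:
  assumes "open A" "closed A"
  shows "indicator_C A x = indicator A x"
proof -
  have "continuous_on (A \<union> - A) (\<lambda>x. if x \<in> A then 1 else 0 :: real)"
    by (rule continuous_on_If) (use assms in auto)
  moreover have "(\<lambda>x. if x \<in> A then 1 else 0 :: real) = indicator A" by (auto simp: indicator_def)
  ultimately have "continuous_on UNIV (indicator A :: 'a \<Rightarrow> real)" by (simp only: Compl_partition)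
  then have "(indicator A :: 'a \<Rightarrow> real) \<in> bcontfun" by (rule bcontfun_normI[of _ 1]) (auto simp: indicator_def)
  then show ?thesis unfolding indicator_C_def by (simp add: Bcontfun_inverse)
qed

definition point_mass :: "'a::topological_space \<Rightarrow> ('a \<Rightarrow>\<^sub>C real) \<Rightarrow>\<^sub>L real" where
  "point_mass x = Blinfun (\<lambda>g. apply_bcontfun g x)"

lemma point_mass_apply [simp]: "point_mass x g = g x"
proof -
  have "bounded_linear (\<lambda>g :: 'a \<Rightarrow>\<^sub>C real. g x)"
    by (rule bounded_linear_intro[where K = 1]) (use norm_bounded[where 'b = real] in auto)
  then show ?thesis unfolding point_mass_def by (simp add: bounded_linear_Blinfun_apply)
qed

lemma norm_point_mass: "norm (point_mass x) \<le> 1"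
  by (rule norm_blinfun_bound) (use norm_bounded[where 'b = real] in auto)

lemma rational_towards_zero:
  fixes w e :: real
  assumes "e > 0"
  shows "\<exists>q\<in>\<rat>. \<bar>q\<bar> \<le> \<bar>w\<bar> \<and> \<bar>q - w\<bar> < e"
proof -
  have pos: "\<exists>q\<in>\<rat>. \<bar>q\<bar> \<le> \<bar>w\<bar> \<and> \<bar>q - w\<bar> < e" if "w > 0" for w
  proof -
    have "max 0 (w - e) < w" using that assms by simp
    then obtain q where "q \<in> \<rat>" "max 0 (w - e) < q" "q < w" using Rats_dense_in_real by blast
    then show ?thesis by (intro bexI[of _ q]) auto
  qed
  consider "w = 0" | "w > 0" | "w < 0" by linarith
  then show ?thesis
  proof cases
    case 1 then show ?thesis using assms by (intro bexI[of _ 0]) auto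
  next
    case 2 then show ?thesis by (rule pos)
  next
    case 3
    then obtain q where "q \<in> \<rat>" "\<bar>q\<bar> \<le> \<bar>- w\<bar>" "\<bar>q - (- w)\<bar> < e" using pos[of "- w"] by auto
    then show ?thesis by (intro bexI[of _ "- q"]) auto
  qed
qed

text \<open>
  The cube \<open>2\<^sup>I\<close> carried by a type: \<open>c x\<close> is the set of the coordinates at which \<open>x\<close> has the value 1.
\<close>

locale cube_coordinates =
  fixes I :: "'i set" and c :: "'a::t2_space \<Rightarrow> 'i set"
  assumes compact_cube: "compact (UNIV :: 'a set)"
    and open_coordinate: "i \<in> I \<Longrightarrow> open {x. i \<in> c x}"
    and closed_coordinate: "i \<in> I \<Longrightarrow> closed {x. i \<in> c x}"
    and bij_coordinates: "bij_betw c UNIV (Pow I)"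
begin

text \<open>
  The points \<open>pt y\<close> with \<open>y\<close> a subset of a finite \<open>S\<close> realise each pattern on \<open>S\<close> once, with the
  default value 0 at all other coordinates.
\<close>

definition pt :: "'i set \<Rightarrow> 'a" where "pt = inv c"

lemma c_pt: "y \<subseteq> I \<Longrightarrow> c (pt y) = y"
  unfolding pt_def using bij_coordinates by (simp add: bij_betw_def f_inv_into_f)

definition cylinder :: "'i set \<Rightarrow> 'i set \<Rightarrow> 'a \<Rightarrow>\<^sub>C real" where
  "cylinder S y = indicator_C {x. c x \<inter> S = y}"

definition chi :: "'i set \<Rightarrow> 'a \<Rightarrow>\<^sub>C real" where
  "chi T = indicator_C {x. T \<subseteq> c x}"

lemma cylinder_apply:
  assumes S: "finite S" "S \<subseteq> I"
  shows "cylinder S y x = (if c x \<inter> S = y then 1 else 0)"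
proof -
  have eq: "{x. c x \<inter> S = y} = (if y \<subseteq> S then (\<Inter>i\<in>S. if i \<in> y then {x. i \<in> c x} else - {x. i \<in> c x}) else {})"
    by (auto split: if_splits)
  have "open (if i \<in> y then {x. i \<in> c x} else - {x. i \<in> c x})"
    "closed (if i \<in> y then {x. i \<in> c x} else - {x. i \<in> c x})" if "i \<in> S" for i
    using that S(2) open_coordinate[of i] closed_coordinate[of i] by (auto simp: subset_iff)
  then have "open (\<Inter>i\<in>S. if i \<in> y then {x. i \<in> c x} else - {x. i \<in> c x})"
    "closed (\<Inter>i\<in>S. if i \<in> y then {x. i \<in> c x} else - {x. i \<in> c x})"
    using S(1) by (intro open_INT closed_INT ballI; blast)+
  then have "open {x. c x \<inter> S = y}" "closed {x. c x \<inter> S = y}"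
    unfolding eq by (cases "y \<subseteq> S"; simp only: if_True if_False open_empty closed_empty)+
  then show ?thesis unfolding cylinder_def by (simp add: indicator_C_apply indicator_def)
qed

lemma chi_apply:
  assumes T: "finite T" "T \<subseteq> I"
  shows "chi T x = (if T \<subseteq> c x then 1 else 0)"
proof -
  have eq: "{x. T \<subseteq> c x} = (\<Inter>i\<in>T. {x. i \<in> c x})" by auto
  have "open {x. T \<subseteq> c x}" "closed {x. T \<subseteq> c x}" unfolding eq
    using T open_coordinate closed_coordinate by (auto intro!: open_INT closed_INT)
  then show ?thesis unfolding chi_def by (simp add: indicator_C_apply indicator_def)
qed

lemma sum_bcontfun_apply: "apply_bcontfun (\<Sum>y\<in>A. f y) x = (\<Sum>y\<in>A. apply_bcontfun (f y :: 'a \<Rightarrow>\<^sub>C real) x)"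
  by (induction A rule: infinite_finite_induct) auto

lemma cylinder_sum_apply:
  assumes S: "finite S" "S \<subseteq> I"
  shows "(\<Sum>y\<in>Pow S. w y *\<^sub>R cylinder S y) x = w (c x \<inter> S)"
proof -
  have "(\<Sum>y\<in>Pow S. w y *\<^sub>R cylinder S y) x = (\<Sum>y\<in>Pow S. if c x \<inter> S = y then w y else 0)"
    unfolding sum_bcontfun_apply by (rule sum.cong) (auto simp: cylinder_apply[OF S])
  also have "\<dots> = w (c x \<inter> S)" using S by (simp add: sum.delta')
  finally show ?thesis .
qed

lemma chi_eq_cylinders:
  assumes S: "finite S" "S \<subseteq> I" and T: "T \<subseteq> S"
  shows "chi T = (\<Sum>y\<in>Pow S. (if T \<subseteq> y then 1 else 0) *\<^sub>R cylinder S y)"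
  by (rule bcontfun_eqI, unfold cylinder_sum_apply[OF S])
    (use assms in \<open>auto simp: chi_apply finite_subset\<close>)

lemma functional_chi:
  fixes \<nu> :: "('a \<Rightarrow>\<^sub>C real) \<Rightarrow>\<^sub>L real"
  assumes S: "finite S" "S \<subseteq> I" and T: "T \<subseteq> S"
  shows "blinfun_apply \<nu> (chi T) = (\<Sum>y\<in>Pow S. (if T \<subseteq> y then blinfun_apply \<nu> (cylinder S y) else 0))"
  unfolding chi_eq_cylinders[OF assms] by (auto simp: blinfun.sum_right blinfun.scaleR_right intro!: sum.cong)

lemma norm_sign_sum:
  assumes S: "finite S" "S \<subseteq> I" and "\<And>y. \<bar>w y\<bar> \<le> (1::real)"
  shows "norm (\<Sum>y\<in>Pow S. w y *\<^sub>R cylinder S y) \<le> 1"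
  by (rule norm_bound) (use assms in \<open>auto simp: cylinder_sum_apply\<close>)

text \<open>
  The sum is the value of \<open>\<nu>\<close> at a function of norm at most 1 that is constant, with value 1, -1 or 0,
  on each cylinder over \<open>S\<close>.
\<close>

lemma variation_cylinders:
  fixes \<nu> :: "('a \<Rightarrow>\<^sub>C real) \<Rightarrow>\<^sub>L real"
  assumes S: "finite S" "S \<subseteq> I"
  shows "(\<Sum>y\<in>Pow S. \<bar>\<nu> (cylinder S y)\<bar>) \<le> norm \<nu>"
proof -
  define f where "f = (\<Sum>y\<in>Pow S. sgn (\<nu> (cylinder S y)) *\<^sub>R cylinder S y)"
  have "norm f \<le> 1" unfolding f_def by (rule norm_sign_sum[OF S]) (auto simp: sgn_if)
  have "(\<Sum>y\<in>Pow S. \<bar>\<nu> (cylinder S y)\<bar>) = \<nu> f"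
    unfolding f_def by (auto simp: blinfun.sum_right blinfun.scaleR_right abs_sgn mult.commute intro!: sum.cong)
  also have "\<dots> \<le> norm \<nu> * norm f" using norm_blinfun[of \<nu> f] by simp
  also have "\<dots> \<le> norm \<nu>" using \<open>norm f \<le> 1\<close> by (simp add: mult_left_le)
  finally show ?thesis .
qed

text \<open>
  The image of the measure \<open>\<nu>\<close> under the map of the cube that sets every coordinate outside \<open>S\<close> to 0.
\<close>

definition restriction :: "'i set \<Rightarrow> (('a \<Rightarrow>\<^sub>C real) \<Rightarrow>\<^sub>L real) \<Rightarrow> (('a \<Rightarrow>\<^sub>C real) \<Rightarrow>\<^sub>L real)" where
  "restriction S \<nu> = (\<Sum>y\<in>Pow S. \<nu> (cylinder S y) *\<^sub>R point_mass (pt y))"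

lemma norm_restriction:
  assumes S: "finite S" "S \<subseteq> I"
  shows "norm (restriction S \<nu>) \<le> norm \<nu>"
proof -
  have "norm (restriction S \<nu>) \<le> (\<Sum>y\<in>Pow S. \<bar>\<nu> (cylinder S y)\<bar>)"
    unfolding restriction_def
    by (rule sum_norm_le) (simp add: mult_left_le norm_point_mass)
  also have "\<dots> \<le> norm \<nu>" by (rule variation_cylinders[OF S])
  finally show ?thesis .
qed

text \<open>
  Setting the coordinates outside \<open>S\<close> to 0 leaves the value of \<open>chi T\<close> unchanged if \<open>T\<close> lies within
  \<open>S\<close>, and makes it 0 otherwise. This is the reason for working with \<open>chi\<close> and not with cylinders.
\<close>

lemma restriction_chi:
  assumes S: "finite S" "S \<subseteq> I" and T: "finite T" "T \<subseteq> I"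
  shows "restriction S \<nu> (chi T) = (if T \<subseteq> S then \<nu> (chi T) else 0)"
proof -
  have "restriction S \<nu> (chi T) = (\<Sum>y\<in>Pow S. \<nu> (cylinder S y) * chi T (pt y))"
    unfolding restriction_def by (simp add: blinfun.sum_left blinfun.scaleR_left)
  also have "\<dots> = (\<Sum>y\<in>Pow S. if T \<subseteq> y then \<nu> (cylinder S y) else 0)"
  proof (rule sum.cong)
    fix y assume "y \<in> Pow S"
    then have "c (pt y) = y" using S by (intro c_pt) auto
    then show "\<nu> (cylinder S y) * chi T (pt y) = (if T \<subseteq> y then \<nu> (cylinder S y) else 0)"
      by (simp add: chi_apply[OF T])
  qed simp
  also have "\<dots> = (if T \<subseteq> S then \<nu> (chi T) else 0)"
  proof (cases "T \<subseteq> S")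
    case True then show ?thesis using functional_chi[OF S True] by simp
  next
    case False
    then have "\<not> T \<subseteq> y" if "y \<in> Pow S" for y using that by blast
    then show ?thesis using False by (simp add: sum.neutral)
  qed
  finally show ?thesis .
qed

text \<open>
  Two functionals with prescribed values on \<open>S\<close> and on \<open>S'\<close> are joined without any compatibility
  assumption, by inclusion and exclusion: adding the restrictions to \<open>S'\<close> and to \<open>S\<close> counts the subsets
  of \<open>S \<inter> S'\<close> twice, and the surplus is subtracted. The norm is at most tripled, whatever \<open>S\<close> and
  \<open>S'\<close> are; on the common subsets the functional \<open>\<nu>'\<close> takes precedence.
\<close>

lemma amalgamate_functionals:
  fixes \<nu> \<nu>' :: "('a \<Rightarrow>\<^sub>C real) \<Rightarrow>\<^sub>L real"
  assumes S: "finite S" "S \<subseteq> I" and S': "finite S'" "S' \<subseteq> I"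
    and "norm \<nu> \<le> B" "norm \<nu>' \<le> B"
  obtains \<mu> :: "('a \<Rightarrow>\<^sub>C real) \<Rightarrow>\<^sub>L real" where "norm \<mu> \<le> 3 * B"
    and "\<And>T. T \<subseteq> S' \<Longrightarrow> \<mu> (chi T) = \<nu>' (chi T)"
    and "\<And>T. T \<subseteq> S \<Longrightarrow> \<not> T \<subseteq> S' \<Longrightarrow> \<mu> (chi T) = \<nu> (chi T)"
proof (rule that[of "restriction S' \<nu>' + restriction S \<nu> - restriction (S \<inter> S') \<nu>"])
  have R: "finite (S \<inter> S')" "S \<inter> S' \<subseteq> I" using S by auto
  have n: "norm (restriction S' \<nu>') \<le> B" "norm (restriction S \<nu>) \<le> B" "norm (restriction (S \<inter> S') \<nu>) \<le> B"
    by (rule order_trans[OF norm_restriction[OF S'] assms(6)] order_trans[OF norm_restriction[OF S] assms(5)]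
        order_trans[OF norm_restriction[OF R] assms(5)])+
  have "norm (restriction S' \<nu>' + restriction S \<nu> - restriction (S \<inter> S') \<nu>)
      \<le> norm (restriction S' \<nu>') + norm (restriction S \<nu>) + norm (restriction (S \<inter> S') \<nu>)"
    using norm_triangle_ineq4[of "restriction S' \<nu>' + restriction S \<nu>" "restriction (S \<inter> S') \<nu>"]
      norm_triangle_ineq[of "restriction S' \<nu>'" "restriction S \<nu>"] by linarith
  then show "norm (restriction S' \<nu>' + restriction S \<nu> - restriction (S \<inter> S') \<nu>) \<le> 3 * B"
    using n by linarith
  fix T
  { assume T: "T \<subseteq> S'"
    then have "finite T" "T \<subseteq> I" using S' finite_subset by auto
    then show "(restriction S' \<nu>' + restriction S \<nu> - restriction (S \<inter> S') \<nu>) (chi T) = \<nu>' (chi T)"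
      using T S S' R by (simp add: blinfun.add_left blinfun.diff_left restriction_chi) }
  { assume T: "T \<subseteq> S" "\<not> T \<subseteq> S'"
    then have "finite T" "T \<subseteq> I" using S finite_subset by auto
    then show "(restriction S' \<nu>' + restriction S \<nu> - restriction (S \<inter> S') \<nu>) (chi T) = \<nu> (chi T)"
      using T S S' R by (simp add: blinfun.add_left blinfun.diff_left restriction_chi) }
qed

text \<open>
  If the coordinates are coded by distinct sets of natural numbers, then finitely many of them are
  already told apart by the traces of their codes on some \<open>{..<m}\<close>. A point whose \<open>i\<close>-th coordinate depends only on the trace of the code of \<open>i\<close> is given by a
  finite set of traces, and such points realise every finite pattern.
\<close>

lemma countable_dense_points:
  assumes I: "I \<lesssim> (UNIV :: nat set set)"
  shows "\<exists>Z. countable Z \<and> (\<forall>S y. finite S \<and> S \<subseteq> I \<and> y \<subseteq> S \<longrightarrow> (\<exists>z\<in>Z. c z \<inter> S = y))"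
proof -
  obtain f :: "'i \<Rightarrow> nat set" where f: "inj_on f I" using I unfolding lepoll_def by blast
  define z where "z = (\<lambda>(m, W). pt {i\<in>I. f i \<inter> {..<m::nat} \<in> W})"
  define \<W> :: "nat set set set" where "\<W> = {W. finite W \<and> W \<subseteq> {A. finite A}}"
  have "countable \<W>" unfolding \<W>_def by (intro countable_Collect_finite_subset countable_Collect_finite)
  then have Z: "countable (z ` (UNIV \<times> \<W>))" by (intro countable_image countable_SIGMA) auto
  have dense: "\<exists>x\<in>z ` (UNIV \<times> \<W>). c x \<inter> S = y" if S: "finite S" "S \<subseteq> I" and y: "y \<subseteq> S" for S y
  proof -
    have "\<forall>\<^sub>F m in sequentially. i \<noteq> j \<longrightarrow> f i \<inter> {..<m} \<noteq> f j \<inter> {..<m}" if "i \<in> S" "j \<in> S" for i j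
    proof (cases "i = j")
      case False
      then have "f i \<noteq> f j" using f S that by (meson inj_onD subsetD)
      then obtain k where k: "(k \<in> f i) \<noteq> (k \<in> f j)" by blast
      have "f i \<inter> {..<m} \<noteq> f j \<inter> {..<m}" if "m \<ge> Suc k" for m
      proof -
        have "k \<in> {..<m}" using that by simp
        then show ?thesis using k by blast
      qed
      then show ?thesis unfolding eventually_sequentially by blast
    qed simp
    then have "\<forall>\<^sub>F m in sequentially. \<forall>i\<in>S. \<forall>j\<in>S. i \<noteq> j \<longrightarrow> f i \<inter> {..<m} \<noteq> f j \<inter> {..<m}"
      using S(1) by (simp add: eventually_ball_finite_distrib)
    from eventually_happens'[OF sequentially_bot this]
    obtain m where "\<forall>i\<in>S. \<forall>j\<in>S. i \<noteq> j \<longrightarrow> f i \<inter> {..<m} \<noteq> f j \<inter> {..<m}" ..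
    then have m: "i = j" if "i \<in> S" "j \<in> S" "f i \<inter> {..<m} = f j \<inter> {..<m}" for i j
      using that by blast
    define W where "W = (\<lambda>i. f i \<inter> {..<m}) ` y"
    have "W \<in> \<W>" unfolding W_def \<W>_def using S(1) y finite_subset by auto
    moreover have "c (z (m, W)) \<inter> S = y"
    proof -
      have "c (z (m, W)) = {i\<in>I. f i \<inter> {..<m} \<in> W}" unfolding z_def by (auto simp: c_pt)
      then show ?thesis using S y m unfolding W_def by blast
    qed
    ultimately show ?thesis by blast
  qed
  show ?thesis
  proof (intro exI conjI allI impI)
    show "countable (z ` (UNIV \<times> \<W>))" by (rule Z)
    fix S y assume "finite S \<and> S \<subseteq> I \<and> y \<subseteq> S"
    then show "\<exists>x\<in>z ` (UNIV \<times> \<W>). c x \<inter> S = y" by (elim conjE) (rule dense)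
  qed
qed

text \<open>
  On functions that depend on the coordinates in \<open>S\<close> only, a functional is a combination of finitely
  many point masses, with the values at the cylinders as weights. The points can be taken from a
  countable dense set, and the weights can be made rational; rounding them towards zero does not
  increase the norm.
\<close>

lemma countable_dense_functionals:
  assumes I: "I \<lesssim> (UNIV :: nat set set)" and B: "B \<ge> 0"
  obtains D :: "(('a \<Rightarrow>\<^sub>C real) \<Rightarrow>\<^sub>L real) set" where "countable D" "D \<noteq> {}" "\<And>d. d \<in> D \<Longrightarrow> norm d \<le> B"
    and "\<And>(\<mu> :: ('a \<Rightarrow>\<^sub>C real) \<Rightarrow>\<^sub>L real) S e. \<lbrakk>norm \<mu> \<le> B; finite S; S \<subseteq> I; e > 0\<rbrakk>
        \<Longrightarrow> \<exists>d\<in>D. \<forall>T\<subseteq>S. \<bar>blinfun_apply d (chi T) - blinfun_apply \<mu> (chi T)\<bar> < e"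
proof -
  obtain Z where Z1: "countable Z"
    and Z2: "\<forall>S y. finite S \<and> S \<subseteq> I \<and> y \<subseteq> S \<longrightarrow> (\<exists>z\<in>Z. c z \<inter> S = y)"
    using countable_dense_points[OF I] by blast
  define comb where "comb l = sum_list (map (\<lambda>p. fst p *\<^sub>R point_mass (snd p)) l)" for l :: "(real \<times> 'a) list"
  define D where "D = comb ` {l \<in> lists (\<rat> \<times> Z). sum_list (map (\<lambda>p. \<bar>fst p\<bar>) l) \<le> B}"
  have nc: "norm (comb l) \<le> sum_list (map (\<lambda>p. \<bar>fst p\<bar>) l)" for l
  proof (induction l)
    case (Cons p l)
    obtain q z where p: "p = (q, z)" by (metis surj_pair)
    have "comb (p # l) = q *\<^sub>R point_mass z + comb l" by (simp add: comb_def p)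
    then have "norm (comb (p # l)) \<le> norm (q *\<^sub>R point_mass z) + norm (comb l)"
      using norm_triangle_ineq by metis
    moreover have "norm (q *\<^sub>R point_mass z) \<le> \<bar>q\<bar>" by (simp add: mult_left_le norm_point_mass)
    moreover have "norm (comb l) \<le> sum_list (map (\<lambda>p. \<bar>fst p\<bar>) l)" by (rule Cons.IH)
    ultimately show ?case unfolding p by simp
  qed (simp add: comb_def)
  show ?thesis
  proof (rule that[of D])
    show "countable D"
      unfolding D_def using Z1 countable_rat
      by (intro countable_image countable_Collect countable_lists countable_SIGMA)
    show "D \<noteq> {}" unfolding D_def using B by (auto intro!: exI[of _ "[]"])
    show "norm d \<le> B" if "d \<in> D" for d using that nc order_trans unfolding D_def by blast
    fix \<mu> :: "('a \<Rightarrow>\<^sub>C real) \<Rightarrow>\<^sub>L real" and S and e :: real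
    assume \<mu>: "norm \<mu> \<le> B" and S: "finite S" "S \<subseteq> I" and e: "e > 0"
    define w where "w y = \<mu> (cylinder S y)" for y
    define \<eta> where "\<eta> = e / real (card (Pow S))"
    have card: "real (card (Pow S)) > 0" using S by (simp add: card_Pow)
    have \<eta>: "\<eta> > 0" using e card by (simp add: \<eta>_def)
    have "\<forall>y. \<exists>q. q \<in> \<rat> \<and> \<bar>q\<bar> \<le> \<bar>w y\<bar> \<and> \<bar>q - w y\<bar> < \<eta>"
      using rational_towards_zero[OF \<eta>] by blast
    from choice[OF this] obtain q where
      "\<forall>y. q y \<in> \<rat> \<and> \<bar>q y\<bar> \<le> \<bar>w y\<bar> \<and> \<bar>q y - w y\<bar> < \<eta>" ..
    then have q: "q y \<in> \<rat>" "\<bar>q y\<bar> \<le> \<bar>w y\<bar>" "\<bar>q y - w y\<bar> < \<eta>" for y by auto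
    have "\<forall>y\<in>Pow S. \<exists>z. z \<in> Z \<and> c z \<inter> S = y" using Z2 S by blast
    from bchoice[OF this] obtain z where z: "\<And>y. y \<in> Pow S \<Longrightarrow> z y \<in> Z \<and> c (z y) \<inter> S = y" by blast
    obtain ys where ys: "set ys = Pow S" "distinct ys" using finite_distinct_list[of "Pow S"] S by auto
    define l where "l = map (\<lambda>y. (q y, z y)) ys"
    have "sum_list (map (\<lambda>p. \<bar>fst p\<bar>) l) = (\<Sum>y\<in>Pow S. \<bar>q y\<bar>)"
      unfolding l_def using ys by (simp add: comp_def sum_list_distinct_conv_sum_set)
    also have "\<dots> \<le> (\<Sum>y\<in>Pow S. \<bar>w y\<bar>)" by (rule sum_mono) (rule q(2))
    also have "\<dots> \<le> B" using variation_cylinders[OF S, of \<mu>] \<mu> by (simp add: w_def)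
    finally have "sum_list (map (\<lambda>p. \<bar>fst p\<bar>) l) \<le> B" .
    moreover have "l \<in> lists (\<rat> \<times> Z)" using q(1) z ys by (auto simp: l_def lists_eq_set)
    ultimately have "comb l \<in> D" unfolding D_def by blast
    moreover have "\<bar>comb l (chi T) - \<mu> (chi T)\<bar> < e" if T: "T \<subseteq> S" for T
    proof -
      have fT: "finite T" "T \<subseteq> I" using T S finite_subset by auto
      have "comb l = (\<Sum>y\<in>Pow S. q y *\<^sub>R point_mass (z y))"
        unfolding comb_def l_def using ys by (simp add: comp_def sum_list_distinct_conv_sum_set)
      then have "comb l (chi T) = (\<Sum>y\<in>Pow S. q y * chi T (z y))"
        by (simp add: blinfun.sum_left blinfun.scaleR_left)
      also have "\<dots> = (\<Sum>y\<in>Pow S. if T \<subseteq> y then q y else 0)"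
      proof (rule sum.cong)
        fix y assume "y \<in> Pow S"
        then have "T \<subseteq> c (z y) \<longleftrightarrow> T \<subseteq> y" using z[of y] T by blast
        then show "q y * chi T (z y) = (if T \<subseteq> y then q y else 0)" by (simp add: chi_apply[OF fT])
      qed simp
      finally have "comb l (chi T) - \<mu> (chi T) =
          (\<Sum>y\<in>Pow S. (if T \<subseteq> y then q y else 0) - (if T \<subseteq> y then w y else 0))"
        unfolding functional_chi[OF S T, of \<mu>] w_def by (simp only: sum_subtractf)
      also have "\<dots> = (\<Sum>y\<in>Pow S. if T \<subseteq> y then q y - w y else 0)" by (intro sum.cong) auto
      finally have "\<bar>comb l (chi T) - \<mu> (chi T)\<bar> \<le> (\<Sum>y\<in>Pow S. \<bar>if T \<subseteq> y then q y - w y else 0\<bar>)"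
        by (simp only: sum_abs)
      also have "\<dots> < (\<Sum>y\<in>Pow S. \<eta>)"
        by (rule sum_strict_mono) (use S q(3) \<eta> in auto)
      also have "\<dots> = e" using card by (simp add: \<eta>_def)
      finally show ?thesis .
    qed
    ultimately show "\<exists>d\<in>D. \<forall>T\<subseteq>S. \<bar>blinfun_apply d (chi T) - blinfun_apply \<mu> (chi T)\<bar> < e" by blast
  qed
qed

text \<open>
  Since \<open>chi S * chi T = chi (S \<union> T)\<close>, the linear span of the functions \<open>chi T\<close> is an algebra. It
  separates points, so it is dense by the Stone-Weierstrass theorem.
\<close>

lemma chi_total:
  assumes W: "subspace W" "closed W" and chi: "\<And>T. finite T \<Longrightarrow> T \<subseteq> I \<Longrightarrow> chi T \<in> W"
  shows "(g :: 'a \<Rightarrow>\<^sub>C real) \<in> W"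
proof -
  define X where "X = chi ` {T. finite T \<and> T \<subseteq> I}"
  define R where "R = apply_bcontfun ` span X"
  have chi_mult: "\<exists>h\<in>span X. \<forall>x. h x = f x * chi T x" if "f \<in> span X" and T: "finite T" "T \<subseteq> I" for f T
    using that(1)
  proof (induction rule: span_induct_alt)
    case base
    then show ?case by (intro bexI[of _ 0]) (auto simp: span_zero)
  next
    case (step r f h)
    then obtain S where S: "finite S" "S \<subseteq> I" "f = chi S" unfolding X_def by blast
    obtain k where k: "k \<in> span X" "\<forall>x. k x = h x * chi T x" using step by blast
    have U: "finite (S \<union> T)" "S \<union> T \<subseteq> I" using S T by auto
    have "chi (S \<union> T) \<in> span X" using U by (intro span_base) (auto simp: X_def)
    then have "r *\<^sub>R chi (S \<union> T) + k \<in> span X" using k(1) by (intro span_add span_scale)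
    moreover have "(r *\<^sub>R chi (S \<union> T) + k) x = (r *\<^sub>R f + h) x * chi T x" for x
      using k(2) by (auto simp: S(3) chi_apply[OF U] chi_apply[OF S(1,2)] chi_apply[OF T] algebra_simps)
    ultimately show ?case by blast
  qed
  have mult: "\<exists>h\<in>span X. \<forall>x. h x = f x * k x" if f: "f \<in> span X" and k: "k \<in> span X" for f k
    using k
  proof (induction rule: span_induct_alt)
    case base
    then show ?case by (intro bexI[of _ 0]) (auto simp: span_zero)
  next
    case (step r e h)
    then obtain T where T: "finite T" "T \<subseteq> I" "e = chi T" unfolding X_def by blast
    obtain u where u: "u \<in> span X" "\<forall>x. u x = f x * chi T x" using chi_mult[OF f T(1,2)] by blast
    obtain v where v: "v \<in> span X" "\<forall>x. v x = f x * h x" using step by blast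
    have "r *\<^sub>R u + v \<in> span X" using u(1) v(1) by (intro span_add span_scale)
    moreover have "(r *\<^sub>R u + v) x = f x * (r *\<^sub>R e + h) x" for x
      using u(2) v(2) by (auto simp: T(3) algebra_simps)
    ultimately show ?case by blast
  qed
  interpret function_ring_on R "UNIV :: 'a set"
  proof
    show "compact (UNIV :: 'a set)" by (rule compact_cube)
    show "continuous_on UNIV f" if "f \<in> R" for f using that unfolding R_def by auto
    show "(\<lambda>x. f x + h x) \<in> R" if fh: "f \<in> R" "h \<in> R" for f h
    proof -
      obtain u v where uv: "u \<in> span X" "v \<in> span X" "f = apply_bcontfun u" "h = apply_bcontfun v"
        using fh unfolding R_def by blast
      then have "(\<lambda>x. f x + h x) = apply_bcontfun (u + v)" by auto
      then show ?thesis unfolding R_def using span_add[OF uv(1,2)] by blast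
    qed
    show "(\<lambda>x. f x * h x) \<in> R" if fh: "f \<in> R" "h \<in> R" for f h
    proof -
      obtain u v where uv: "u \<in> span X" "v \<in> span X" "f = apply_bcontfun u" "h = apply_bcontfun v"
        using fh unfolding R_def by blast
      then obtain w where w: "w \<in> span X" "\<forall>x. w x = u x * v x" using mult by blast
      then have "(\<lambda>x. f x * h x) = apply_bcontfun w" using uv by auto
      then show ?thesis unfolding R_def using w(1) by blast
    qed
    show "(\<lambda>_. r) \<in> R" for r
    proof -
      have "chi {} \<in> span X" by (rule span_base) (auto simp: X_def)
      then have "r *\<^sub>R chi {} \<in> span X" by (rule span_scale)
      moreover have "(\<lambda>_. r) = apply_bcontfun (r *\<^sub>R chi {})" by (auto simp: chi_apply)
      ultimately show ?thesis unfolding R_def by blast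
    qed
    show "\<exists>f\<in>R. f x \<noteq> f y" if "x \<noteq> y" for x y
    proof -
      have "c x \<noteq> c y" "c x \<subseteq> I" "c y \<subseteq> I"
        using that bij_coordinates unfolding bij_betw_def by (auto dest: injD)
      then obtain i where i: "i \<in> I" "(i \<in> c x) \<noteq> (i \<in> c y)" by blast
      have "chi {i} \<in> span X" by (rule span_base) (use i in \<open>auto simp: X_def\<close>)
      then have "apply_bcontfun (chi {i}) \<in> R" unfolding R_def by blast
      moreover have "chi {i} x \<noteq> chi {i} y" using i by (auto simp: chi_apply)
      ultimately show ?thesis by blast
    qed
  qed
  have "span X \<subseteq> W" using W(1) chi unfolding X_def by (intro span_minimal) auto
  have "g \<in> closure (span X)"
    unfolding closure_approachable
  proof (intro allI impI)
    fix e :: real assume e: "e > 0"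
    obtain f where "f \<in> R" "\<forall>x\<in>UNIV. \<bar>g x - f x\<bar> < e / 2"
      using Stone_Weierstrass_basic[of "apply_bcontfun g" "e/2"] e by auto
    then obtain u where u: "u \<in> span X" "\<And>x. \<bar>g x - u x\<bar> < e / 2" unfolding R_def by auto
    have "norm (u - g) \<le> e / 2"
      by (rule norm_bound) (use u(2) less_imp_le in \<open>auto simp: abs_minus_commute\<close>)
    then show "\<exists>u\<in>span X. dist u g < e" using u(1) e by (auto simp: dist_norm intro!: bexI[of _ u])
  qed
  also have "closure (span X) \<subseteq> W" using \<open>span X \<subseteq> W\<close> W(2) by (rule closure_minimal)
  finally show ?thesis .
qed

section \<open>Functionals with prescribed limits\<close>

text \<open>
  The central step. The hypothesis gives, for each finite part of the task, functionals that are
  good for almost all \<open>n\<close>; Martin's axiom yields a single sequence that is good for every part in the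
  limit. The requirements of the forcing are the indices \<open>i \<in> I\<close> and the precisions \<open>1 / (k + 1)\<close>: a
  finite set \<open>F\<close> of them asks for all values at \<open>chi T\<close>, for \<open>T\<close> within its support, up to all its
  precisions. Feasibility refers to functionals of norm at most \<open>B\<close>, while the selected ones may have
  norm \<open>3 * B\<close>, as this is what \<open>amalgamate_functionals\<close> produces from two feasible ones.
\<close>

lemma martin_functionals:
  fixes N :: "'n set" and a :: "'n \<Rightarrow> 'i set \<Rightarrow> real"
  assumes I: "I \<lesssim> (UNIV :: nat set set)" and MA: "martin_axiom TYPE(nat set) I"
    and N: "countable N" and B: "B \<ge> 0"
    and approx: "\<And>S e. \<lbrakk>finite S; S \<subseteq> I; e > 0\<rbrakk> \<Longrightarrow>
      finite {n\<in>N. \<not> (\<exists>\<nu> :: ('a \<Rightarrow>\<^sub>C real) \<Rightarrow>\<^sub>L real. norm \<nu> \<le> B \<and> (\<forall>T\<subseteq>S. \<bar>blinfun_apply \<nu> (chi T) - a n T\<bar> < e))}"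
  shows "\<exists>\<mu> :: 'n \<Rightarrow> ('a \<Rightarrow>\<^sub>C real) \<Rightarrow>\<^sub>L real. (\<forall>n\<in>N. norm (\<mu> n) \<le> 3 * B) \<and>
    (\<forall>T e. finite T \<longrightarrow> T \<subseteq> I \<longrightarrow> e > 0 \<longrightarrow> finite {n\<in>N. \<bar>blinfun_apply (\<mu> n) (chi T) - a n T\<bar> \<ge> e})"
proof -
  define J where "J = I <+> (UNIV :: nat set)"
  define supp where "supp F = Inl -` F" for F :: "('i + nat) set"
  define lev where "lev F = Inr -` F" for F :: "('i + nat) set"
  define P :: "('i + nat) set \<Rightarrow> 'n \<Rightarrow> (('a \<Rightarrow>\<^sub>C real) \<Rightarrow>\<^sub>L real) set" where
    "P F n = {\<nu>. \<forall>T k. T \<subseteq> supp F \<longrightarrow> k \<in> lev F \<longrightarrow> \<bar>blinfun_apply \<nu> (chi T) - a n T\<bar> < 1 / Suc k}" for F n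
  define V where "V F n \<longleftrightarrow> (\<exists>\<nu>\<in>P F n. norm \<nu> \<le> B)" for F n
  have sF: "finite (supp F)" "supp F \<subseteq> I" and lF: "finite (lev F)" if "finite F" "F \<subseteq> J" for F
    using that by (auto simp: supp_def lev_def J_def intro!: finite_vimageI)
  have "3 * B \<ge> 0" using B by simp
  from countable_dense_functionals[OF I this] obtain D :: "(('a \<Rightarrow>\<^sub>C real) \<Rightarrow>\<^sub>L real) set" where
    D: "countable D" "D \<noteq> {}" "\<And>d. d \<in> D \<Longrightarrow> norm d \<le> 3 * B"
    and Dd: "\<And>(\<mu> :: ('a \<Rightarrow>\<^sub>C real) \<Rightarrow>\<^sub>L real) S e. \<lbrakk>norm \<mu> \<le> 3 * B; finite S; S \<subseteq> I; e > 0\<rbrakk>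
        \<Longrightarrow> \<exists>d\<in>D. \<forall>T\<subseteq>S. \<bar>blinfun_apply d (chi T) - blinfun_apply \<mu> (chi T)\<bar> < e" by blast
  have MA': "martin_axiom TYPE(('n \<rightharpoonup> (('a \<Rightarrow>\<^sub>C real) \<Rightarrow>\<^sub>L real)) \<times> ('i + nat) set) (J <+> (UNIV :: nat set))"
    unfolding J_def by (intro martin_axiom_Plus_nat martin_axiom_universe[OF I MA])
  have anti: "P F' n \<subseteq> P F n" if "F \<subseteq> F'" for F F' n
    using that unfolding P_def supp_def lev_def by blast
  have cofin: "finite {n\<in>N. \<not> V F n}" if F: "finite F" "F \<subseteq> J" for F
  proof -
    define e where "e = 1 / real (Suc (Max (insert 0 (lev F))))"
    have e: "e \<le> 1 / real (Suc k)" if "k \<in> lev F" for k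
      unfolding e_def using that lF[OF F] by (intro divide_left_mono) auto
    have "{n\<in>N. \<not> V F n} \<subseteq> {n\<in>N. \<not> (\<exists>\<nu> :: ('a \<Rightarrow>\<^sub>C real) \<Rightarrow>\<^sub>L real. norm \<nu> \<le> B \<and> (\<forall>T\<subseteq>supp F. \<bar>blinfun_apply \<nu> (chi T) - a n T\<bar> < e))}"
      unfolding V_def P_def using e by (blast intro: order_less_le_trans)
    moreover have "finite \<dots>" by (rule approx[OF sF[OF F]]) (simp add: e_def)
    ultimately show ?thesis by (rule finite_subset)
  qed
  \<comment> \<open>On the sets \<open>T\<close> that belong to both supports the amalgamated functional follows \<open>\<nu>'\<close>, so
    \<open>\<nu>'\<close> has to be the one with the better precision.\<close>
  have one_side: "\<exists>d\<in>D. d \<in> P F n \<and> d \<in> P F' n"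
    if F: "finite F" "F \<subseteq> J" and F': "finite F'" "F' \<subseteq> J" and V: "V F n" "V F' n"
      and finer: "\<And>k. k \<in> lev F \<Longrightarrow> \<exists>k'\<in>lev F'. k \<le> k'" for F F' n
  proof -
    obtain \<nu> \<nu>' where \<nu>: "\<nu> \<in> P F n" "norm \<nu> \<le> B" and \<nu>': "\<nu>' \<in> P F' n" "norm \<nu>' \<le> B"
      using V unfolding V_def by blast
    obtain \<mu> where n\<mu>: "norm \<mu> \<le> 3 * B" and \<mu>1: "\<And>T. T \<subseteq> supp F' \<Longrightarrow> blinfun_apply \<mu> (chi T) = \<nu>' (chi T)"
      and \<mu>2: "\<And>T. T \<subseteq> supp F \<Longrightarrow> \<not> T \<subseteq> supp F' \<Longrightarrow> blinfun_apply \<mu> (chi T) = \<nu> (chi T)"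
      using amalgamate_functionals[OF sF[OF F] sF[OF F'] \<nu>(2) \<nu>'(2)] by blast
    have "\<mu> \<in> P F' n" using \<nu>'(1) \<mu>1 unfolding P_def by simp
    moreover have "\<mu> \<in> P F n"
      unfolding P_def
    proof (intro CollectI allI impI)
      fix T k assume T: "T \<subseteq> supp F" and k: "k \<in> lev F"
      show "\<bar>blinfun_apply \<mu> (chi T) - a n T\<bar> < 1 / real (Suc k)"
      proof (cases "T \<subseteq> supp F'")
        case True
        obtain k' where k': "k' \<in> lev F'" "k \<le> k'" using finer[OF k] by blast
        have "\<bar>blinfun_apply \<mu> (chi T) - a n T\<bar> < 1 / real (Suc k')"
          using \<nu>'(1) True k'(1) \<mu>1[OF True] unfolding P_def by simp
        also have "\<dots> \<le> 1 / real (Suc k)" using k'(2) by (intro divide_left_mono) auto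
        finally show ?thesis .
      next
        case False
        then show ?thesis using \<nu>(1) T k \<mu>2[OF T False] unfolding P_def by simp
      qed
    qed
    moreover
    \<comment> \<open>Finitely many strict inequalities leave room \<open>e\<close> for replacing \<open>\<mu>\<close> by a member of \<open>D\<close>.\<close>
    define S where "S = supp F \<union> supp F'"
    define E where "E = (\<lambda>(T, k). 1 / real (Suc k) - \<bar>blinfun_apply \<mu> (chi T) - a n T\<bar>) `
      (Pow (supp F) \<times> lev F \<union> Pow (supp F') \<times> lev F')"
    define e where "e = Min (insert 1 E)"
    have S: "finite S" "S \<subseteq> I" using sF[OF F] sF[OF F'] by (auto simp: S_def)
    have fE: "finite (insert 1 E)" unfolding E_def using sF[OF F] sF[OF F'] lF[OF F] lF[OF F'] by simp
    have "\<forall>x\<in>insert 1 E. x > 0"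
      using \<open>\<mu> \<in> P F' n\<close> \<open>\<mu> \<in> P F n\<close> unfolding E_def P_def by auto
    then have e: "e > 0" unfolding e_def using fE by (subst Min_gr_iff) auto
    obtain d where d: "d \<in> D" "\<And>T. T \<subseteq> S \<Longrightarrow> \<bar>blinfun_apply d (chi T) - blinfun_apply \<mu> (chi T)\<bar> < e"
      using Dd[OF n\<mu> S e] by blast
    have close: "\<bar>blinfun_apply d (chi T) - a n T\<bar> < 1 / real (Suc k)"
      if Tk: "(T, k) \<in> Pow (supp F) \<times> lev F \<union> Pow (supp F') \<times> lev F'" for T k
    proof -
      have "1 / real (Suc k) - \<bar>blinfun_apply \<mu> (chi T) - a n T\<bar> \<in> insert 1 E"
        unfolding E_def by (rule insertI2, rule image_eqI[OF _ Tk]) simp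
      then have "e \<le> 1 / real (Suc k) - \<bar>blinfun_apply \<mu> (chi T) - a n T\<bar>" unfolding e_def by (rule Min_le[OF fE])
      moreover have "\<bar>blinfun_apply d (chi T) - blinfun_apply \<mu> (chi T)\<bar> < e" using d(2) Tk by (auto simp: S_def)
      ultimately show ?thesis by linarith
    qed
    then have "d \<in> P F n" "d \<in> P F' n" unfolding P_def by auto
    then show ?thesis using d(1) by blast
  qed
  have linked: "\<exists>d\<in>D. d \<in> P F n \<and> d \<in> P F' n"
    if F: "finite F" "F \<subseteq> J" and F': "finite F'" "F' \<subseteq> J" and V: "V F n" "V F' n" for F F' n
  proof (cases "\<forall>k\<in>lev F. \<exists>k'\<in>lev F'. k \<le> k'")
    case True
    then show ?thesis using one_side[OF F F' V] by blast
  next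
    case False
    then obtain k where k: "k \<in> lev F" "\<And>k'. k' \<in> lev F' \<Longrightarrow> k' < k" by (auto simp: not_le)
    then have "\<exists>k\<in>lev F. k' \<le> k" if "k' \<in> lev F'" for k' using that less_imp_le by blast
    then show ?thesis using one_side[OF F' F V(2,1)] by blast
  qed
  obtain g where g: "\<And>n. n \<in> N \<Longrightarrow> g n \<in> D"
    and gP: "\<And>F. \<lbrakk>finite F; F \<subseteq> J\<rbrakk> \<Longrightarrow> finite {n\<in>N. g n \<notin> P F n}"
    using martin_selection[where V = V and P = P, OF MA' N D(1,2) anti linked cofin] by blast
  show ?thesis
  proof (intro exI conjI ballI allI impI)
    show "norm (g n) \<le> 3 * B" if "n \<in> N" for n using D(3) g that by blast
    fix T :: "'i set" and e :: real assume T: "finite T" "T \<subseteq> I" and e: "e > 0"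
    obtain k where k: "1 / real (Suc k) < e" using nat_approx_posE[OF e] by blast
    define F where "F = Inl ` T \<union> {Inr k}"
    have F: "finite F" "F \<subseteq> J" "supp F = T" "lev F = {k}" using T by (auto simp: F_def J_def supp_def lev_def)
    have "{n\<in>N. \<bar>blinfun_apply (g n) (chi T) - a n T\<bar> \<ge> e} \<subseteq> {n\<in>N. g n \<notin> P F n}"
      using k F(3,4) unfolding P_def by force
    then show "finite {n\<in>N. \<bar>blinfun_apply (g n) (chi T) - a n T\<bar> \<ge> e}" using gP[OF F(1,2)] by (rule finite_subset)
  qed
qed

end

section \<open>The extension property\<close>

text \<open>
  At a point outside \<open>N\<close>, the complement of the finite set where \<open>\<bar>f\<bar> \<ge> e\<close> is a neighbourhood on which
  \<open>f\<close> is small.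
\<close>

lemma continuous_map_vanishing_on_isolated_points:
  fixes f :: "'l \<Rightarrow> real"
  assumes X: "Hausdorff_space X" and N: "\<And>n. n \<in> N \<Longrightarrow> openin X {n}"
    and zero: "\<And>x. x \<in> topspace X \<Longrightarrow> x \<notin> N \<Longrightarrow> f x = 0"
    and fin: "\<And>e. e > 0 \<Longrightarrow> finite {n\<in>N. e \<le> \<bar>f n\<bar>}"
  shows "continuous_map X euclideanreal f"
proof -
  have "continuous_map X Met_TC.mtopology f"
    unfolding Met_TC.continuous_map_to_metric
  proof (intro ballI allI impI)
    fix x and e :: real assume x: "x \<in> topspace X" and e: "e > 0"
    show "\<exists>U. openin X U \<and> x \<in> U \<and> (\<forall>y\<in>U. f y \<in> Met_TC.mball (f x) e)"
    proof (cases "x \<in> N")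
      case True
      then show ?thesis using N e by (intro exI[of _ "{x}"]) auto
    next
      case False
      define A where "A = {n\<in>N. e \<le> \<bar>f n\<bar>}"
      have "A \<subseteq> topspace X" using N openin_subset unfolding A_def by fastforce
      then have "closedin X A"
        using fin[OF e] X by (auto simp: A_def intro: closedin_Hausdorff_finite)
      then have "openin X (topspace X - A)" by (rule openin_diff[OF openin_topspace])
      moreover have "\<bar>f y\<bar> < e" if "y \<in> topspace X - A" for y
        using that zero[of y] e unfolding A_def by (cases "y \<in> N") auto
      ultimately show ?thesis using x False zero[OF x False]
        by (intro exI[of _ "topspace X - A"]) (auto simp: A_def dist_real_def)
    qed
  qed
  then show ?thesis by simp
qed

context cube_coordinates
begin

text \<open>
  By Tietze's theorem each evaluation at \<open>chi T\<close> extends from the ball \<open>M\<^sub>1\<close> to a continuous function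
  \<open>h T\<close> on \<open>L'\<close>. Near the ball the values of these functions are close to those of an actual
  functional in it, and by compactness only finitely many points of \<open>L'\<close> lie outside a given open
  neighbourhood of the ball. So functionals \<open>\<mu> n\<close> can be attached to the isolated points \<open>n\<close> with
  \<open>\<mu> n (chi T) - h T n\<close>
  tending to 0 for every \<open>T\<close>. This makes \<open>E (chi T)\<close> continuous, and density of the span of the \<open>chi T\<close>
  together with the common norm bound gives continuity of every \<open>E g\<close>.
\<close>

lemma star_extension:
  assumes I: "I \<lesssim> (UNIV :: nat set set)" and MA: "martin_axiom TYPE(nat set) I"
  shows "star_extension_property TYPE('a) TYPE('l)"
  unfolding star_extension_property_def
proof (intro allI impI)
  fix L' :: "'l topology" and e :: "(('a \<Rightarrow>\<^sub>C real) \<Rightarrow>\<^sub>L real) \<Rightarrow> 'l"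
  define N where "N = topspace L' - e ` topspace M1"
  assume "countable_discrete_extension M1 L' e"
  then have comp: "compact_space L'" and haus: "Hausdorff_space L'" and emb: "embedding_map M1 L' e"
    and N: "countable N" and disc: "subtopology L' N = discrete_topology N"
    unfolding countable_discrete_extension_def N_def by auto
  have top: "topspace M1 = cball (0 :: ('a \<Rightarrow>\<^sub>C real) \<Rightarrow>\<^sub>L real) 1"
    unfolding M1_def by (simp add: strong_operator_topology_topspace)
  define MM where "MM = e ` topspace M1"
  have N_MM: "N = topspace L' - MM" by (simp only: N_def MM_def)
  obtain e' where hom: "homeomorphic_maps M1 (subtopology L' MM) e e'"
    using emb unfolding embedding_map_def homeomorphic_map_maps MM_def by blast
  have ce: "continuous_map M1 L' e" using hom unfolding homeomorphic_maps_def by (simp add: continuous_map_in_subtopology)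
  have MM: "MM \<subseteq> topspace L'" unfolding MM_def using ce by (rule continuous_map_image_subset_topspace)
  have e'e: "e' (e \<nu>) = \<nu>" if "\<nu> \<in> topspace M1" for \<nu>
    using hom that unfolding homeomorphic_maps_def by blast
  have "compactin M1 (topspace M1)"
    using banach_alaoglu unfolding top unfolding M1_def by (simp add: compactin_subtopology strong_operator_topology_topspace)
  then have "compactin L' MM" unfolding MM_def using ce by (rule image_compactin)
  then have clMM: "closedin L' MM" by (rule compactin_imp_closedin[OF haus])
  have opN: "openin L' N" unfolding N_MM using clMM by (rule openin_diff[OF openin_topspace])
  have iso: "openin L' {n}" if "n \<in> N" for n
  proof (rule openin_trans_full[OF _ opN])
    show "openin (subtopology L' N) {n}" unfolding disc using that by simp
  qed
  have norm': "normal_space L'"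
    using comp haus by (simp add: compact_Hausdorff_or_regular_imp_normal_space)
  have ev: "continuous_map (subtopology L' MM) euclideanreal (\<lambda>x. e' x g)" for g
  proof -
    have "continuous_map (subtopology L' MM) strong_operator_topology e'"
      using hom unfolding homeomorphic_maps_def M1_def by (simp add: continuous_map_in_subtopology)
    then show ?thesis using continuous_map_compose[OF _ strong_operator_topology_continuous_evaluation]
      by (auto simp: comp_def)
  qed
  have "\<exists>h. continuous_map L' euclideanreal h \<and> (\<forall>x\<in>MM. h x = e' x (chi T))" for T
  proof -
    obtain k where "continuous_map L' euclideanreal k" "\<And>x. x \<in> MM \<Longrightarrow> k x = e' x (chi T)"
      by (rule Tietze_extension_realinterval[OF norm' clMM is_interval_univ UNIV_not_empty ev[of "chi T"] subset_UNIV])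
        (rule that)
    then show ?thesis by (intro exI[of _ k]) simp
  qed
  from choice[OF allI[OF this]] obtain h where
    h: "\<forall>T. continuous_map L' euclideanreal (h T) \<and> (\<forall>x\<in>MM. h T x = e' x (chi T))" ..
  have hc: "continuous_map L' euclideanreal (h T)" for T using h by simp
  have hM: "h T x = e' x (chi T)" if "x \<in> MM" for T x using h that by simp
  have approx: "finite {n\<in>N. \<not> (\<exists>\<nu> :: ('a \<Rightarrow>\<^sub>C real) \<Rightarrow>\<^sub>L real. norm \<nu> \<le> 1 \<and> (\<forall>T\<subseteq>S. \<bar>blinfun_apply \<nu> (chi T) - h T n\<bar> < r))}"
    (is "finite ?bad")
    if S: "finite S" "S \<subseteq> I" and r: "r > 0" for S r
  proof -
    define U where "U \<nu> = {x\<in>topspace L'. \<forall>T\<in>Pow S. h T x \<in> ball (blinfun_apply \<nu> (chi T)) r}"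
      for \<nu> :: "('a \<Rightarrow>\<^sub>C real) \<Rightarrow>\<^sub>L real"
    have "openin L' (U \<nu>)" for \<nu>
    proof -
      have "U \<nu> = topspace L' \<inter> (\<Inter>T\<in>Pow S. {x\<in>topspace L'. h T x \<in> ball (blinfun_apply \<nu> (chi T)) r})"
        unfolding U_def by auto
      moreover have "openin L' {x\<in>topspace L'. h T x \<in> ball (blinfun_apply \<nu> (chi T)) r}" for T
        by (rule openin_continuous_map_preimage[OF hc]) simp
      ultimately show ?thesis using S(1) by (auto intro!: openin_Int openin_INT)
    qed
    then have "openin L' (\<Union>\<nu>\<in>topspace M1. U \<nu>)" by blast
    then have "closedin L' (topspace L' - (\<Union>\<nu>\<in>topspace M1. U \<nu>))" by (rule closedin_diff[OF closedin_topspace])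
    moreover have "topspace L' - (\<Union>\<nu>\<in>topspace M1. U \<nu>) = ?bad"
    proof -
      have "x \<in> U (e' x)" if "x \<in> MM" for x
        using that MM hM[OF that] r unfolding U_def by auto
      moreover have "e' x \<in> topspace M1" if "x \<in> MM" for x using that e'e unfolding MM_def by auto
      ultimately have sub: "MM \<subseteq> (\<Union>\<nu>\<in>topspace M1. U \<nu>)" by blast
      have mem: "x \<in> U \<nu> \<longleftrightarrow> (\<forall>T\<subseteq>S. \<bar>blinfun_apply \<nu> (chi T) - h T x\<bar> < r)" if "x \<in> N" for x \<nu>
        using that by (auto simp: U_def N_MM dist_real_def)
      have "topspace L' - (\<Union>\<nu>\<in>topspace M1. U \<nu>) = {n\<in>N. \<not> (\<exists>\<nu>. norm \<nu> \<le> 1 \<and> n \<in> U \<nu>)}"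
        using sub unfolding N_MM top by auto
      also have "\<dots> = ?bad" using mem by blast
      finally show ?thesis .
    qed
    ultimately have "compactin L' ?bad" using closedin_compact_space[OF comp] by simp
    then have "compactin (subtopology L' N) ?bad" by (auto simp: compactin_subtopology)
    then show ?thesis unfolding disc by (simp add: compactin_discrete_topology)
  qed
  obtain \<mu> :: "'l \<Rightarrow> ('a \<Rightarrow>\<^sub>C real) \<Rightarrow>\<^sub>L real" where n\<mu>: "\<forall>n\<in>N. norm (\<mu> n) \<le> 3 * 1"
    and \<mu>: "\<forall>T r. finite T \<longrightarrow> T \<subseteq> I \<longrightarrow> r > 0 \<longrightarrow> finite {n\<in>N. \<bar>blinfun_apply (\<mu> n) (chi T) - h T n\<bar> \<ge> r}"
    using martin_functionals[OF I MA N zero_le_one approx] by blast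
  define \<mu>' where "\<mu>' x = (if x \<in> MM then e' x else \<mu> x)" for x
  define E where "E g x = blinfun_apply (\<mu>' x) g" for g x
  have bound: "\<bar>E g x\<bar> \<le> 3 * norm g" if x: "x \<in> topspace L'" for g x
  proof -
    have "norm (\<mu>' x) \<le> 3"
    proof (cases "x \<in> MM")
      case True
      then have "e' x \<in> topspace M1" using e'e unfolding MM_def by auto
      then show ?thesis using True by (simp add: \<mu>'_def top)
    next
      case False
      then show ?thesis using n\<mu> x by (simp add: \<mu>'_def N_MM)
    qed
    then show ?thesis using norm_blinfun[of "\<mu>' x" g] mult_right_mono[of "norm (\<mu>' x)" 3 "norm g"]
      by (simp add: E_def)
  qed
  define W where "W = {g. continuous_map L' euclideanreal (E g)}"
  have "chi T \<in> W" if T: "finite T" "T \<subseteq> I" for T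
  proof -
    have "continuous_map L' euclideanreal (\<lambda>x. E (chi T) x - h T x)"
    proof (rule continuous_map_vanishing_on_isolated_points[OF haus iso])
      show "E (chi T) x - h T x = 0" if "x \<in> topspace L'" "x \<notin> N" for x
        using that hM[of x T] by (simp add: N_MM E_def \<mu>'_def)
      fix r :: real assume "r > 0"
      then have "finite {n\<in>N. \<bar>blinfun_apply (\<mu> n) (chi T) - h T n\<bar> \<ge> r}" using \<mu> T by blast
      moreover have "{n\<in>N. r \<le> \<bar>E (chi T) n - h T n\<bar>} = {n\<in>N. \<bar>blinfun_apply (\<mu> n) (chi T) - h T n\<bar> \<ge> r}"
        by (auto simp: N_MM E_def \<mu>'_def)
      ultimately show "finite {n\<in>N. r \<le> \<bar>E (chi T) n - h T n\<bar>}" by simp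
    qed
    from continuous_map_add[OF this hc[of T]] show ?thesis unfolding W_def by simp
  qed
  moreover have "subspace W"
    unfolding W_def E_def
    by (rule subspaceI) (auto simp: blinfun.zero_right blinfun.add_right blinfun.scaleR_right
        intro!: continuous_map_add continuous_map_real_mult_left)
  moreover have "closed W"
    unfolding closed_sequential_limits
  proof (intro allI impI, elim conjE)
    fix u g assume u: "\<forall>n. u n \<in> W" and lim: "u \<longlonglongrightarrow> g"
    have "continuous_map L' Met_TC.mtopology (E g)"
    proof (rule Met_TC.continuous_map_uniform_limit[where F = sequentially and f = "\<lambda>n. E (u n)"])
      show "\<forall>\<^sub>F n in sequentially. continuous_map L' Met_TC.mtopology (E (u n))"
        using u by (simp add: W_def mtopology_is_euclidean)
      fix r :: real assume "r > 0"
      then have "\<forall>\<^sub>F n in sequentially. dist (u n) g < r / 3"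
        using lim by (intro tendstoD) auto
      then show "\<forall>\<^sub>F n in sequentially. \<forall>x\<in>topspace L'. E g x \<in> UNIV \<and> dist (E (u n) x) (E g x) < r"
      proof (rule eventually_mono, intro ballI conjI UNIV_I)
        fix n x assume n: "dist (u n) g < r / 3" and x: "x \<in> topspace L'"
        have "dist (E (u n) x) (E g x) = \<bar>E (u n - g) x\<bar>" by (simp add: E_def dist_real_def blinfun.diff_right)
        also have "\<dots> \<le> 3 * dist (u n) g" using bound[OF x] by (simp add: dist_norm)
        also have "\<dots> < r" using n by simp
        finally show "dist (E (u n) x) (E g x) < r" .
      qed
    qed simp
    then show "g \<in> W" by (simp add: W_def mtopology_is_euclidean)
  qed
  ultimately have W: "g \<in> W" for g using chi_total by blast
  have "bounded_operator_into_C L' E"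
    unfolding bounded_operator_into_C_def
  proof (intro conjI allI ballI)
    show "continuous_map L' euclideanreal (E g)" for g using W unfolding W_def by blast
    show "linear (\<lambda>g. E g x)" for x unfolding E_def by (rule bounded_linear.linear[OF blinfun.bounded_linear_right])
    show "\<exists>B. \<forall>g. \<forall>x\<in>topspace L'. \<bar>E g x\<bar> \<le> B * norm g" using bound by blast
  qed
  moreover have "E g (e \<nu>) = blinfun_apply \<nu> g" if "\<nu> \<in> topspace M1" for g \<nu>
    using that e'e by (simp add: E_def \<mu>'_def MM_def)
  ultimately show "\<exists>E. bounded_operator_into_C L' E \<and> (\<forall>g. \<forall>\<nu>\<in>topspace M1. E g (e \<nu>) = blinfun_apply \<nu> g)"
    by blast
qed

end

section \<open>Twisted sums\<close>

context cube_coordinates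
begin

text \<open>
  The coordinate functionals of \<open>c\<^sub>0\<close> extend to functionals \<open>\<phi> n\<close> on the middle space with a common
  norm bound. A bounded left inverse of \<open>i\<close> is obtained by correcting them to \<open>\<phi> n - \<mu> n \<circ> q\<close> so that
  they tend to 0 pointwise, for the correction does not change the values on the range of \<open>i\<close>.

  Let \<open>lift\<close> be a right inverse of \<open>q\<close> of linear growth. The difference of two elements with the same
  image under \<open>q\<close> comes from \<open>c\<^sub>0\<close>, so \<open>\<phi> n\<close> tends to 0 at it. In the limit \<open>\<phi> n \<circ> lift\<close> therefore
  behaves like a bounded functional on each finite-dimensional space of functions, and
  \<open>martin_functionals\<close> provides \<open>\<mu>\<close>.
\<close>

lemma twisted_sum_c0_splits:
  fixes i :: "c0 \<Rightarrow> 'x::banach" and q :: "'x \<Rightarrow> ('a \<Rightarrow>\<^sub>C real)"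
  assumes I: "I \<lesssim> (UNIV :: nat set set)" and MA: "martin_axiom TYPE(nat set) I"
    and tw: "twisted_sum i q"
  shows "trivial_twisted_sum i q"
proof -
  have bi: "bounded_linear i" and bq: "bounded_linear q" and inj: "inj i"
    and ker: "range i = {x. q x = 0}" and surj: "surj q"
    using tw by (simp_all only: twisted_sum_def)
  interpret i: bounded_linear i by (rule bi)
  interpret q: bounded_linear q by (rule bq)
  have "closed {x. q x = 0}"
    by (intro closed_Collect_eq linear_continuous_on[OF bq] continuous_on_const)
  then have "closed (range i)" unfolding ker .
  from open_mapping_closed_range[OF bi this] obtain Ci where Ci: "Ci > 0"
    and Ci': "\<And>y. y \<in> range i \<Longrightarrow> \<exists>z. i z = y \<and> norm z \<le> Ci * norm y" by metis
  have low: "norm z \<le> Ci * norm (i z)" for z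
  proof -
    obtain z' where "i z' = i z" "norm z' \<le> Ci * norm (i z)" using Ci'[of "i z"] by blast
    then show ?thesis using injD[OF inj] by metis
  qed
  have "closed (range q)" using surj by simp
  from open_mapping_closed_range[OF bq this] obtain Cq where Cq: "Cq > 0"
    and Cq': "\<And>g. g \<in> range q \<Longrightarrow> \<exists>x. q x = g \<and> norm x \<le> Cq * norm g" by metis
  have ex_lift: "\<forall>g. \<exists>x. q x = g \<and> norm x \<le> Cq * norm g" using Cq' surj by simp
  from choice[OF ex_lift] obtain lift where
    lift0: "\<forall>g. q (lift g) = g \<and> norm (lift g) \<le> Cq * norm g" ..
  then have lift: "q (lift g) = g" "norm (lift g) \<le> Cq * norm g" for g by auto
  define co where "co n z = apply_bcontfun (seq_of_c0 z) n" for n z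
  have co_add: "co n (z + w) = co n z + co n w" and co_scale: "co n (r *\<^sub>R z) = r * co n z"
    and co_0: "co n 0 = 0" for n z w r
    by (auto simp: co_def plus_c0.rep_eq scaleR_c0.rep_eq zero_c0.rep_eq)
  have co_norm: "\<bar>co n z\<bar> \<le> norm z" for n z
    using norm_bounded[of "seq_of_c0 z" n] by (simp add: co_def norm_c0.rep_eq)
  have co_lim: "(\<lambda>n. co n z) \<longlonglongrightarrow> 0" for z using seq_of_c0[of z] by (simp add: co_def)
  have "\<exists>\<phi> :: 'x \<Rightarrow>\<^sub>L real. norm \<phi> \<le> Ci \<and> (\<forall>z. blinfun_apply \<phi> (i z) = co n z)" for n
  proof -
    define G where "G = range (\<lambda>z. (i z, co n z))"
    have "subspace G"
      unfolding G_def
    proof (rule subspaceI)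
      show "0 \<in> range (\<lambda>z. (i z, co n z))" by (rule range_eqI[of _ _ 0]) (simp add: i.zero co_0 zero_prod_def)
    next
      fix u v assume "u \<in> range (\<lambda>z. (i z, co n z))" "v \<in> range (\<lambda>z. (i z, co n z))"
      then obtain z w where "u = (i z, co n z)" "v = (i w, co n w)" by (elim rangeE)
      then have "u + v = (i (z + w), co n (z + w))" by (simp add: i.add co_add)
      then show "u + v \<in> range (\<lambda>z. (i z, co n z))" by (rule range_eqI)
    next
      fix r u assume "u \<in> range (\<lambda>z. (i z, co n z))"
      then obtain z where "u = (i z, co n z)" by (elim rangeE)
      then have "r *\<^sub>R u = (i (r *\<^sub>R z), co n (r *\<^sub>R z))" by (simp add: i.scaleR co_scale)
      then show "r *\<^sub>R u \<in> range (\<lambda>z. (i z, co n z))" by (rule range_eqI)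
    qed
    moreover have "r \<le> Ci * norm x" if "(x, r) \<in> G" for x r
    proof -
      obtain z where "x = i z" "r = co n z" using \<open>(x, r) \<in> G\<close> unfolding G_def by blast
      then show ?thesis using low[of z] co_norm[of n z] by simp
    qed
    ultimately obtain \<phi> :: "'x \<Rightarrow>\<^sub>L real" where "norm \<phi> \<le> Ci" "\<And>x r. (x, r) \<in> G \<Longrightarrow> blinfun_apply \<phi> x = r"
      using hahn_banach_norm[of G Ci] Ci by (metis less_imp_le)
    then show ?thesis unfolding G_def by blast
  qed
  from choice[OF allI[OF this]] obtain \<phi> :: "nat \<Rightarrow> 'x \<Rightarrow>\<^sub>L real" where
    \<phi>0: "\<forall>n. norm (\<phi> n) \<le> Ci \<and> (\<forall>z. blinfun_apply (\<phi> n) (i z) = co n z)" ..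
  then have \<phi>n: "norm (\<phi> n) \<le> Ci" and \<phi>i: "blinfun_apply (\<phi> n) (i z) = co n z" for n z by auto
  have \<phi>b: "\<bar>\<phi> n x\<bar> \<le> Ci * norm x" for n x
    using norm_blinfun[of "\<phi> n" x] mult_right_mono[OF \<phi>n[of n], of "norm x"] by simp
  have \<phi>ker: "(\<lambda>n. \<phi> n (x - y)) \<longlonglongrightarrow> 0" if "q x = q y" for x y
  proof -
    have "x - y \<in> range i" unfolding ker using that by (simp add: q.diff)
    then obtain z where "x - y = i z" by blast
    then show ?thesis using co_lim[of z] by (simp add: \<phi>i)
  qed
  define a where "a n T = \<phi> n (lift (chi T))" for n T
  define B where "B = Ci * Cq + 1"
  have B: "B \<ge> 0" using Ci Cq by (simp add: B_def)
  have approx: "finite {n\<in>UNIV. \<not> (\<exists>\<nu> :: ('a \<Rightarrow>\<^sub>C real) \<Rightarrow>\<^sub>L real. norm \<nu> \<le> B \<and> (\<forall>T\<subseteq>S. \<bar>blinfun_apply \<nu> (chi T) - a n T\<bar> < e))}"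
    if S: "finite S" "S \<subseteq> I" and e: "e > 0" for S e
  proof -
    define x where "x y = lift (cylinder S y)" for y
    define sg where "sg A y = (if y \<in> A then 1 else - 1 :: real)" for A and y :: "'i set"
    define v where "v A = (\<Sum>y\<in>Pow S. sg A y *\<^sub>R x y)" for A
    define w where "w A = lift (q (v A))" for A
    \<comment> \<open>The absolute values of the weights used below add up to \<open>\<phi> n (v A)\<close>, where \<open>A\<close> records
      their signs, so it is enough to bound \<open>\<phi> n\<close> at the finitely many vectors \<open>v A\<close>.\<close>
    have ev1: "\<forall>\<^sub>F n in sequentially. \<forall>A\<in>Pow (Pow S). \<phi> n (v A) \<le> B"
    proof (rule eventually_ball_finite)
      show "finite (Pow (Pow S))" using S by simp
      show "\<forall>A\<in>Pow (Pow S). \<forall>\<^sub>F n in sequentially. \<phi> n (v A) \<le> B"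
      proof
        fix A assume "A \<in> Pow (Pow S)"
        have "q (v A) = (\<Sum>y\<in>Pow S. sg A y *\<^sub>R cylinder S y)"
          by (simp add: v_def q.sum q.scaleR x_def lift)
        then have "norm (q (v A)) \<le> 1" using norm_sign_sum[OF S, of "sg A"] by (simp add: sg_def)
        then have "norm (w A) \<le> Cq"
          using lift(2)[of "q (v A)"] mult_left_mono[of "norm (q (v A))" 1 Cq] Cq unfolding w_def by linarith
        then have w: "\<phi> n (w A) \<le> Ci * Cq" for n
          using \<phi>b[of n "w A"] mult_left_mono[of "norm (w A)" Cq Ci] Ci by linarith
        have "(\<lambda>n. \<phi> n (v A - w A)) \<longlonglongrightarrow> 0" by (rule \<phi>ker) (simp add: w_def lift)
        then have "\<forall>\<^sub>F n in sequentially. \<phi> n (v A - w A) < 1" by (rule order_tendstoD) simp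
        then show "\<forall>\<^sub>F n in sequentially. \<phi> n (v A) \<le> B"
        proof (rule eventually_mono)
          fix n assume "\<phi> n (v A - w A) < 1"
          then show "\<phi> n (v A) \<le> B" using w[of n] by (simp add: B_def blinfun.diff_right)
        qed
      qed
    qed
    define u where "u T = (\<Sum>y\<in>Pow S. (if T \<subseteq> y then 1 else 0) *\<^sub>R x y)" for T
    have ev2: "\<forall>\<^sub>F n in sequentially. \<forall>T\<in>Pow S. \<bar>\<phi> n (u T - lift (chi T))\<bar> < e"
    proof (rule eventually_ball_finite)
      show "finite (Pow S)" using S by simp
      show "\<forall>T\<in>Pow S. \<forall>\<^sub>F n in sequentially. \<bar>\<phi> n (u T - lift (chi T))\<bar> < e"
      proof
        fix T assume "T \<in> Pow S"
        then have "q (u T) = q (lift (chi T))"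
          using chi_eq_cylinders[OF S, of T] by (simp add: u_def q.sum q.scaleR x_def lift)
        then have "(\<lambda>n. \<phi> n (u T - lift (chi T))) \<longlonglongrightarrow> 0" by (rule \<phi>ker)
        from tendstoD[OF this e] show "\<forall>\<^sub>F n in sequentially. \<bar>\<phi> n (u T - lift (chi T))\<bar> < e" by (simp add: dist_real_def)
      qed
    qed
    have "\<forall>\<^sub>F n in sequentially. \<exists>\<nu> :: ('a \<Rightarrow>\<^sub>C real) \<Rightarrow>\<^sub>L real. norm \<nu> \<le> B \<and> (\<forall>T\<subseteq>S. \<bar>blinfun_apply \<nu> (chi T) - a n T\<bar> < e)"
      using ev1 ev2
    proof eventually_elim
      case (elim n)
      define \<nu> where "\<nu> = (\<Sum>y\<in>Pow S. \<phi> n (x y) *\<^sub>R point_mass (pt y))"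
      define A where "A = {y\<in>Pow S. \<phi> n (x y) \<ge> 0}"
      have "norm \<nu> \<le> (\<Sum>y\<in>Pow S. \<bar>\<phi> n (x y)\<bar>)"
        unfolding \<nu>_def by (rule sum_norm_le) (simp add: mult_left_le norm_point_mass)
      also have "\<dots> = \<phi> n (v A)"
        unfolding v_def blinfun.sum_right by (rule sum.cong) (auto simp: A_def sg_def blinfun.scaleR_right)
      also have "\<dots> \<le> B" using elim(1) by (auto simp: A_def)
      finally have "norm \<nu> \<le> B" .
      moreover have "\<bar>blinfun_apply \<nu> (chi T) - a n T\<bar> < e" if T: "T \<subseteq> S" for T
      proof -
        have fT: "finite T" "T \<subseteq> I" using T S finite_subset by auto
        have "\<nu> (chi T) = (\<Sum>y\<in>Pow S. \<phi> n (x y) * chi T (pt y))"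
          unfolding \<nu>_def by (simp add: blinfun.sum_left blinfun.scaleR_left)
        also have "\<dots> = (\<Sum>y\<in>Pow S. (if T \<subseteq> y then 1 else 0) * \<phi> n (x y))"
        proof (rule sum.cong)
          fix y assume "y \<in> Pow S"
          then have "c (pt y) = y" using S by (intro c_pt) auto
          then show "\<phi> n (x y) * chi T (pt y) = (if T \<subseteq> y then 1 else 0) * \<phi> n (x y)"
            by (simp add: chi_apply[OF fT])
        qed simp
        also have "\<dots> = \<phi> n (u T)" unfolding u_def by (simp add: blinfun.sum_right blinfun.scaleR_right)
        finally show ?thesis using elim(2) T by (simp add: a_def blinfun.diff_right)
      qed
      ultimately show ?case by blast
    qed
    then show ?thesis by (simp add: cofinite_eq_sequentially[symmetric] eventually_cofinite)
  qed
  obtain \<mu> :: "nat \<Rightarrow> ('a \<Rightarrow>\<^sub>C real) \<Rightarrow>\<^sub>L real" where \<mu>n: "\<forall>n\<in>UNIV. norm (\<mu> n) \<le> 3 * B"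
    and \<mu>: "\<forall>T r. finite T \<longrightarrow> T \<subseteq> I \<longrightarrow> r > 0 \<longrightarrow> finite {n\<in>UNIV. \<bar>blinfun_apply (\<mu> n) (chi T) - a n T\<bar> \<ge> r}"
    using martin_functionals[OF I MA countableI_type B approx] by blast
  define \<psi> where "\<psi> n x = \<phi> n x - \<mu> n (q x)" for n x
  have \<psi>diff: "\<psi> n (x - y) = \<psi> n x - \<psi> n y" for n x y
    by (simp add: \<psi>_def blinfun.diff_right q.diff)
  have \<psi>add: "\<psi> n (x + y) = \<psi> n x + \<psi> n y" for n x y
    by (simp add: \<psi>_def blinfun.add_right q.add)
  have \<psi>scale: "\<psi> n (r *\<^sub>R x) = r * \<psi> n x" for n r x
    by (simp add: \<psi>_def blinfun.scaleR_right q.scaleR algebra_simps)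
  obtain Kq where Kq: "Kq \<ge> 0" "\<And>x. norm (q x) \<le> norm x * Kq" using q.nonneg_bounded by blast
  define K where "K = Ci + 3 * B * Kq"
  have K: "K > 0" using Ci B Kq by (simp add: K_def add_pos_nonneg)
  have \<psi>b: "\<bar>\<psi> n x\<bar> \<le> K * norm x" for n x
  proof -
    have "\<bar>\<mu> n (q x)\<bar> \<le> norm (\<mu> n) * norm (q x)" using norm_blinfun[of "\<mu> n" "q x"] by simp
    also have "\<dots> \<le> (3 * B) * (norm x * Kq)" using \<mu>n Kq B by (intro mult_mono) auto
    finally show ?thesis using \<phi>b[of n x] by (simp add: \<psi>_def K_def algebra_simps)
  qed
  define W where "W = {x. (\<lambda>n. \<psi> n x) \<longlonglongrightarrow> 0}"
  have subW: "x + y \<in> W" "r *\<^sub>R x \<in> W" if "x \<in> W" "y \<in> W" for x y r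
    using that tendsto_add[of "\<lambda>n. \<psi> n x" 0 sequentially "\<lambda>n. \<psi> n y" 0]
    by (auto simp: W_def \<psi>add \<psi>scale intro: tendsto_mult_right_zero)
  have kerW: "x \<in> W" if "q x = q y" "y \<in> W" for x y
  proof -
    have "(\<lambda>n. \<psi> n (x - y)) \<longlonglongrightarrow> 0" using \<phi>ker[OF that(1)] that(1) by (simp add: \<psi>_def q.diff)
    then have "x - y \<in> W" by (simp add: W_def)
    then show ?thesis using subW(1)[OF _ that(2), of "x - y"] by simp
  qed
  \<comment> \<open>The functionals \<open>\<psi> n\<close> are uniformly bounded, so the space on which they tend to 0 is closed.\<close>
  have closeW: "x \<in> W" if near: "\<And>d. d > 0 \<Longrightarrow> \<exists>y\<in>W. norm (x - y) < d" for x
    unfolding W_def mem_Collect_eq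
  proof (rule tendstoI)
    fix e :: real assume e: "e > 0"
    obtain y where y: "y \<in> W" "norm (x - y) < e / 2 / K" using near[of "e / 2 / K"] e K by auto
    have "\<forall>\<^sub>F n in sequentially. dist (\<psi> n y) 0 < e / 2"
      using y(1) e unfolding W_def by (intro tendstoD) auto
    then show "\<forall>\<^sub>F n in sequentially. dist (\<psi> n x) 0 < e"
    proof (rule eventually_mono)
      fix n assume "dist (\<psi> n y) 0 < e / 2"
      moreover have "\<bar>\<psi> n x - \<psi> n y\<bar> \<le> K * norm (x - y)" using \<psi>b[of n "x - y"] by (simp add: \<psi>diff)
      moreover have "K * norm (x - y) < e / 2" using y(2) K by (simp add: field_simps)
      ultimately show "dist (\<psi> n x) 0 < e" by (simp add: dist_real_def)
    qed
  qed
  \<comment> \<open>Since \<open>W\<close> contains the kernel of \<open>q\<close>, membership of \<open>x\<close> in \<open>W\<close> depends on \<open>q x\<close> only; this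
    turns the claim about the middle space into one about functions on the cube.\<close>
  define V where "V = {g. lift g \<in> W}"
  have VW: "x \<in> W" if "q x \<in> V" for x
    using that kerW[of x "lift (q x)"] by (simp add: V_def lift)
  have "chi T \<in> V" if T: "finite T" "T \<subseteq> I" for T
    unfolding V_def W_def mem_Collect_eq
  proof (rule tendstoI)
    fix r :: real assume "r > 0"
    then have "finite {n. \<not> \<bar>\<mu> n (chi T) - a n T\<bar> < r}" using \<mu> T by (simp add: not_less)
    then have "\<forall>\<^sub>F n in sequentially. \<bar>\<mu> n (chi T) - a n T\<bar> < r"
      by (simp add: cofinite_eq_sequentially[symmetric] eventually_cofinite)
    then show "\<forall>\<^sub>F n in sequentially. dist (\<psi> n (lift (chi T))) 0 < r"
      by (rule eventually_mono) (simp add: \<psi>_def a_def lift dist_real_def abs_minus_commute)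
  qed
  moreover have "subspace V"
  proof (rule subspaceI)
    have "0 \<in> W" by (simp add: W_def \<psi>_def q.zero)
    then show "0 \<in> V" using kerW[of "lift 0" 0] by (simp add: V_def lift q.zero)
    show "f + g \<in> V" if "f \<in> V" "g \<in> V" for f g
      using that subW(1)[of "lift f" "lift g"] kerW[of "lift (f + g)" "lift f + lift g"]
      by (simp add: V_def lift q.add)
    show "r *\<^sub>R f \<in> V" if "f \<in> V" for r f
      using that subW(2)[of "lift f" "lift f" r] kerW[of "lift (r *\<^sub>R f)" "r *\<^sub>R lift f"]
      by (simp add: V_def lift q.scaleR)
  qed
  moreover have "closed V"
    unfolding closed_limpt islimpt_approachable
  proof (intro allI impI)
    fix g assume g: "\<forall>e>0. \<exists>f\<in>V. f \<noteq> g \<and> dist f g < e"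
    show "g \<in> V"
      unfolding V_def mem_Collect_eq
    proof (rule closeW)
      fix d :: real assume d: "d > 0"
      then have "d / Cq > 0" using Cq by simp
      then obtain f where f: "f \<in> V" "dist f g < d / Cq" using g by blast
      define y where "y = lift g - lift (g - f)"
      have "q y = f" by (simp add: y_def q.diff lift)
      then have "y \<in> W" using f(1) by (intro VW) simp
      moreover have "norm (lift g - y) < d"
      proof -
        have "norm (lift g - y) \<le> Cq * norm (g - f)" using lift(2)[of "g - f"] by (simp add: y_def)
        also have "\<dots> < d" using f(2) Cq by (simp add: dist_norm norm_minus_commute field_simps)
        finally show ?thesis .
      qed
      ultimately show "\<exists>y\<in>W. norm (lift g - y) < d" by blast
    qed
  qed
  ultimately have V: "g \<in> V" for g using chi_total by blast
  have lim: "(\<lambda>n. \<psi> n x) \<longlonglongrightarrow> 0" for x using VW[OF V, of x] by (simp add: W_def)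
  define r where "r x = Abs_c0 (Bcontfun (\<lambda>n. \<psi> n x))" for x
  have rn: "co n (r x) = \<psi> n x" for n x
  proof -
    have "(\<lambda>n. \<psi> n x) \<in> bcontfun"
      by (rule bcontfun_normI[of _ "K * norm x"]) (use \<psi>b in auto)
    then have ap: "apply_bcontfun (Bcontfun (\<lambda>n. \<psi> n x)) = (\<lambda>n. \<psi> n x)" by (rule Bcontfun_inverse)
    then have "seq_of_c0 (r x) = Bcontfun (\<lambda>n. \<psi> n x)"
      unfolding r_def by (intro Abs_c0_inverse) (simp add: lim)
    then show ?thesis by (simp add: co_def ap)
  qed
  have eqI: "z = w" if "\<And>n. co n z = co n w" for z w
    using that unfolding co_def by (metis bcontfun_eqI seq_of_c0_inject)
  have "bounded_linear r"
  proof (rule bounded_linear_intro)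
    show "r (x + y) = r x + r y" for x y by (rule eqI) (simp add: rn co_add \<psi>add)
    show "r (t *\<^sub>R x) = t *\<^sub>R r x" for t x by (rule eqI) (simp add: rn co_scale \<psi>scale)
    show "norm (r x) \<le> norm x * K" for x
      unfolding norm_c0.rep_eq
      by (rule norm_bound) (use \<psi>b[of _ x] rn[of _ x] in \<open>simp add: co_def mult.commute\<close>)
  qed
  moreover have "r (i z) = z" for z
  proof (rule eqI)
    have "q (i z) = 0" using ker by blast
    then show "co n (r (i z)) = co n z" for n by (simp add: rn \<psi>_def \<phi>i)
  qed
  ultimately show ?thesis unfolding trivial_twisted_sum_def using tw by blast
qed

end

section \<open>Coordinates on a space homeomorphic to the cube\<close>

lemma cube_coordinates_homeomorphic:
  fixes I :: "'i set"
  assumes "(euclidean :: 'a::t2_space topology) homeomorphic_space cantor_cube I"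
  obtains c :: "'a::t2_space \<Rightarrow> 'i set" where "cube_coordinates I c"
proof -
  obtain h k where hk: "homeomorphic_maps (euclidean :: 'a topology) (cantor_cube I) h k"
    using assms unfolding homeomorphic_space_def by blast
  have ch: "continuous_map (euclidean :: 'a topology) (cantor_cube I) h"
    and kh: "\<And>x. k (h x) = x" and hk': "\<And>y. y \<in> topspace (cantor_cube I) \<Longrightarrow> h (k y) = y"
    using hk unfolding homeomorphic_maps_def by auto
  have top: "topspace (cantor_cube I) = (\<Pi>\<^sub>E i\<in>I. UNIV)" by (simp add: cantor_cube_def)
  define c where "c x = {i\<in>I. h x i}" for x
  have "compact_space (cantor_cube I)"
    unfolding cantor_cube_def compact_space_product_topology by (simp add: compact_space_discrete_topology)
  then have "compact_space (euclidean :: 'a topology)"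
    using assms homeomorphic_compact_space by blast
  then have "compact (UNIV :: 'a set)" by (simp add: compact_space_def)
  moreover have "open {x. i \<in> c x} \<and> closed {x. i \<in> c x}" if i: "i \<in> I" for i
  proof -
    have "continuous_map (euclidean :: 'a topology) (discrete_topology UNIV) (\<lambda>x. h x i)"
      using continuous_map_compose[OF ch[unfolded cantor_cube_def] continuous_map_product_projection[OF i]]
      by (simp add: comp_def)
    then have "openin (euclidean :: 'a topology) {x \<in> topspace euclidean. h x i \<in> A}" for A
      by (rule openin_continuous_map_preimage) simp
    then have "open {x. h x i \<in> A}" for A by simp
    from this[of "{True}"] this[of "{False}"] have "open {x. h x i}" "open {x. \<not> h x i}" by simp_all
    then show ?thesis using i by (simp add: c_def closed_def Collect_neg_eq)
  qed
  moreover have "bij_betw c UNIV (Pow I)"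
  proof (rule bij_betwI')
    have hE: "h x \<in> (\<Pi>\<^sub>E i\<in>I. UNIV)" for x
      using continuous_map_image_subset_topspace[OF ch] top by auto
    show "(c x = c y) = (x = y)" for x y
    proof
      assume "c x = c y"
      then have "h x i = h y i" if "i \<in> I" for i using that unfolding c_def by blast
      then have "h x = h y" by (rule PiE_ext[OF hE hE])
      then show "x = y" using kh by metis
    qed simp
    show "c x \<in> Pow I" for x by (auto simp: c_def)
    show "\<exists>x\<in>UNIV. y = c x" if "y \<in> Pow I" for y
    proof -
      define f where "f = restrict (\<lambda>i. i \<in> y) I"
      have "f \<in> topspace (cantor_cube I)" by (simp add: top f_def)
      then have "h (k f) = f" by (rule hk')
      then have "c (k f) = y" using that by (auto simp: c_def f_def)
      then show ?thesis by blast
    qed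
  qed
  ultimately have "cube_coordinates I c" unfolding cube_coordinates_def by blast
  then show ?thesis by (rule that)
qed

theorem corollary5p2:
  fixes I :: "'i set"
  assumes "I \<prec> (UNIV :: nat set set)"
    and "martin_axiom TYPE(nat set) I"
    and "(euclidean :: 'a::t2_space topology) homeomorphic_space cantor_cube I"
  shows "star_extension_property TYPE('a) TYPE('l) \<and>
    (\<forall>(i :: c0 \<Rightarrow> 'x::banach) (q :: 'x \<Rightarrow> ('a \<Rightarrow>\<^sub>C real)).
       twisted_sum i q \<longrightarrow> trivial_twisted_sum i q)"
proof -
  obtain c :: "'a \<Rightarrow> 'i set" where "cube_coordinates I c"
    using assms(3) by (rule cube_coordinates_homeomorphic)
  then interpret cube_coordinates I c .
  have "I \<lesssim> (UNIV :: nat set set)" using assms(1) by (simp add: lesspoll_def)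
  then show ?thesis using star_extension twisted_sum_c0_splits assms(2) by blast
qed

end
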